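(* Suppose $u=(\rho,m):\mathbb{R}^+\times\mathbb{R}\to\mathbb{R}^2$ is a bounded entropy solution to the isentropic Euler equations with $\gamma=3$. Then, for any Lipschitz curve $h:[0,T]\to\mathbb{R}$, with $u^\pm$ the strong traces of $u$ along $h$, for almost every $t\in[0,T]$, either $u^+(t)=u^-(t)$ or $(u^-(t),u^+(t))$ is an admissible shock with speed $\dot h(t)$.
   Context: The isentropic Euler equations with $\gamma=3$, for $(t,x)\in\mathbb{R}^+\times\mathbb{R}$, are $$\rho_t+m_x=0,\qquad m_t+\left(\frac{m^2}{\rho}+\frac{\rho^3}{12}\right)_x=0,$$ with unknown $u=(\rho,m)$ and flux $f(\rho,m)=(m,\,m^2/\rho+\rho^3/12)$. An entropy pair is a pair $(\eta,q)$ of functions of the state $(\rho,m)$ such that $\eta$ is convex, $\eta,q\in C(\mathbb{R}^+\times\mathbb{R})$ and $q'=\eta' f'$. A bounded entropy solution is a measurable $u=(\rho,m)$ on $\mathbb{R}^+\times\mathbb{R}$ with $\rho\ge 0$ and $\rho,\ m/\rho\in L^\infty(\mathbb{R}^+\times\mathbb{R})$ (so $m=0$ where $\rho=0$, and $m^2/\rho$ is read as $0$ there) which satisfies the system in the sense of distributions and satisfies $\eta(u)_t+q(u)_x\le 0$ in the sense of distributions for every entropy pair. At vacuum states $\rho=0$, $\eta(u)$ and $q(u)$ are understood as the limits of $\eta,q$ as $\rho\to0^+$ with $m/\rho$ bounded (for pairs for which these limits exist). Strong traces of $u$ along a Lipschitz $h:[0,T]\to\mathbb{R}$ are functions $u^+,u^-\in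 L^\infty([0,T];\mathbb{R}^2)$ such that $$\lim_{k\to\infty}\operatorname*{ess\,sup}_{y\in(0,1/k)}\int_0^T |u(t,h(t)+y)-u^+(t)|+|u(t,h(t)-y)-u^-(t)|\,dt=0;$$ such functions exist for every bounded entropy solution of this system and every Lipschitz $h$. $(u_L,u_R)$ with $u_L\neq u_R$ is an admissible shock with speed $\sigma$ if $f(u_R)-f(u_L)=\sigma(u_R-u_L)$ and $q(u_R)-q(u_L)\le\sigma(\eta(u_R)-\eta(u_L))$ for every entropy pair $(\eta,q)$. *)

theory Defs
  imports "HOL-Analysis.Analysis" "HOL-Probability.Essential_Supremum"
begin

text \<open>Points of space-time are pairs \<open>(t, x)\<close>, states are pairs \<open>(\<rho>, m)\<close>.\<close>

definition space_time :: "(real \<times> real) set" where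
  "space_time = {0<..} \<times> UNIV"

definition nonvacuum :: "(real \<times> real) set" where
  "nonvacuum = {(\<rho>, m). 0 < \<rho>}"

text \<open>The only vacuum state is \<open>(0, 0)\<close>, since \<open>m = 0\<close> where \<open>\<rho> = 0\<close>.\<close>

definition states :: "(real \<times> real) set" where
  "states = insert (0, 0) nonvacuum"

text \<open>As \<open>x / 0 = 0\<close>, the flux at the vacuum state is \<open>(0, 0)\<close>, as required.\<close>

definition flux :: "real \<times> real \<Rightarrow> real \<times> real" where
  "flux = (\<lambda>(\<rho>, m). (m, m\<^sup>2 / \<rho> + \<rho> ^ 3 / 12))"

primrec Ck :: "nat \<Rightarrow> ('a::euclidean_space \<Rightarrow> real) \<Rightarrow> bool" where
  "Ck 0 \<phi> \<longleftrightarrow> continuous_on UNIV \<phi>"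
| "Ck (Suc n) \<phi> \<longleftrightarrow> (\<forall>z. \<phi> differentiable (at z)) \<and>
     (\<forall>b\<in>Basis. Ck n (\<lambda>z. frechet_derivative \<phi> (at z) b))"

definition test_function :: "(real \<times> real \<Rightarrow> real) \<Rightarrow> bool" where
  "test_function \<phi> \<longleftrightarrow> (\<forall>n. Ck n \<phi>) \<and>
     compact (closure {z. \<phi> z \<noteq> 0}) \<and> closure {z. \<phi> z \<noteq> 0} \<subseteq> space_time"

text \<open>The action of the distribution \<open>w\<^sub>t + g\<^sub>x\<close> on \<open>\<phi>\<close>.\<close>

definition weak_div ::
  "(real \<times> real \<Rightarrow> real) \<Rightarrow> (real \<times> real \<Rightarrow> real) \<Rightarrow> (real \<times> real \<Rightarrow> real) \<Rightarrow> real" where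
  "weak_div w g \<phi> = - (LINT z|lebesgue_on space_time.
     w z * frechet_derivative \<phi> (at z) (1, 0) + g z * frechet_derivative \<phi> (at z) (0, 1))"

text \<open>The values of \<open>\<eta>\<close> and \<open>q\<close> outside \<open>nonvacuum\<close> are not constrained by this definition;
  the derivatives are the Jacobians, so that \<open>q' = \<eta>' f'\<close> is a composition of linear maps.\<close>

definition entropy_pair :: "(real \<times> real \<Rightarrow> real) \<Rightarrow> (real \<times> real \<Rightarrow> real) \<Rightarrow> bool" where
  "entropy_pair \<eta> q \<longleftrightarrow>
     convex_on nonvacuum \<eta> \<and> continuous_on nonvacuum \<eta> \<and> continuous_on nonvacuum q \<and>
     (\<forall>v\<in>nonvacuum. \<exists>D\<eta> Df. (\<eta> has_derivative D\<eta>) (at v) \<and>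
        (flux has_derivative Df) (at v) \<and> (q has_derivative (D\<eta> \<circ> Df)) (at v))"

text \<open>The limit of \<open>g\<close> as \<open>\<rho> \<longlongrightarrow> 0\<close> from the right with \<open>m / \<rho>\<close> bounded exists and is
  the value of \<open>g\<close> at the vacuum state. Because an entropy pair is unconstrained at \<open>(0, 0)\<close>,
  every pair with limits there agrees on \<open>nonvacuum\<close> with one that has this property.\<close>

definition vacuum_limit :: "(real \<times> real \<Rightarrow> real) \<Rightarrow> bool" where
  "vacuum_limit g \<longleftrightarrow>
     (\<forall>M. (g \<longlongrightarrow> g (0, 0)) (at (0, 0) within {(\<rho>, m). 0 < \<rho> \<and> \<bar>m\<bar> \<le> M * \<rho>}))"

text \<open>The entropy inequality is required of the pairs that can be evaluated on \<open>u\<close>: those with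
  limits at vacuum, and all of them if \<open>u\<close> does not take the vacuum state.\<close>

definition bounded_entropy_solution :: "(real \<times> real \<Rightarrow> real \<times> real) \<Rightarrow> bool" where
  "bounded_entropy_solution u \<longleftrightarrow>
     u \<in> borel_measurable (lebesgue_on space_time) \<and>
     (\<exists>M. AE z in lebesgue_on space_time.
        u z \<in> states \<and> \<bar>fst (u z)\<bar> \<le> M \<and> \<bar>snd (u z) / fst (u z)\<bar> \<le> M) \<and>
     (\<forall>\<phi>. test_function \<phi> \<longrightarrow>
        weak_div (fst \<circ> u) (fst \<circ> flux \<circ> u) \<phi> = 0 \<and>
        weak_div (snd \<circ> u) (snd \<circ> flux \<circ> u) \<phi> = 0) \<and>
     (\<forall>\<eta> q. entropy_pair \<eta> q \<and>
        (vacuum_limit \<eta> \<and> vacuum_limit q \<or> (AE z in lebesgue_on space_time. u z \<in> nonvacuum)) \<longrightarrow>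
        (\<forall>\<phi>. test_function \<phi> \<and> (\<forall>z. 0 \<le> \<phi> z) \<longrightarrow> weak_div (\<eta> \<circ> u) (q \<circ> u) \<phi> \<le> 0))"

definition Linf :: "real \<Rightarrow> (real \<Rightarrow> real \<times> real) \<Rightarrow> bool" where
  "Linf T w \<longleftrightarrow> w \<in> borel_measurable (lebesgue_on {0..T}) \<and>
     (\<exists>B. AE t in lebesgue_on {0..T}. norm (w t) \<le> B)"

definition strong_traces ::
  "real \<Rightarrow> (real \<times> real \<Rightarrow> real \<times> real) \<Rightarrow> (real \<Rightarrow> real) \<Rightarrow>
   (real \<Rightarrow> real \<times> real) \<Rightarrow> (real \<Rightarrow> real \<times> real) \<Rightarrow> bool" where
  "strong_traces T u h u_plus u_minus \<longleftrightarrow> Linf T u_plus \<and> Linf T u_minus \<and>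
     (\<lambda>k. esssup (lebesgue_on {0<..<1 / real k}) (\<lambda>y.
        \<integral>\<^sup>+t. ennreal (norm (u (t, h t + y) - u_plus t) + norm (u (t, h t - y) - u_minus t))
          \<partial>lebesgue_on {0..T})) \<longlonglongrightarrow> 0"

definition admissible_shock :: "real \<times> real \<Rightarrow> real \<times> real \<Rightarrow> real \<Rightarrow> bool" where
  "admissible_shock u\<^sub>L u\<^sub>R \<sigma> \<longleftrightarrow>
     u\<^sub>L \<in> states \<and> u\<^sub>R \<in> states \<and> u\<^sub>L \<noteq> u\<^sub>R \<and>
     flux u\<^sub>R - flux u\<^sub>L = \<sigma> *\<^sub>R (u\<^sub>R - u\<^sub>L) \<and>
     (\<forall>\<eta> q. entropy_pair \<eta> q \<and>
        (vacuum_limit \<eta> \<and> vacuum_limit q \<or> u\<^sub>L \<in> nonvacuum \<and> u\<^sub>R \<in> nonvacuum) \<longrightarrow>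
        q u\<^sub>R - q u\<^sub>L \<le> \<sigma> * (\<eta> u\<^sub>R - \<eta> u\<^sub>L))"

end

theory Submission
  imports Defs "HOL-Computational_Algebra.Polynomial"
begin

text \<open>
  The proof zooms in on a point \<open>(t0, h t0)\<close> of the curve. In the variables \<open>s = (t - t0) / \<epsilon>\<close>,
  \<open>y = (x - h t) / \<epsilon>\<close> the strong traces make \<open>u\<close> converge, as \<open>\<epsilon>\<close> tends to \<open>0\<close>, to the step function
  with value \<open>u_minus t0\<close> on \<open>y < 0\<close> and \<open>u_plus t0\<close> on \<open>y > 0\<close>. If \<open>h\<close> has derivative \<open>\<sigma>\<close> at \<open>t0\<close>, the curve
  becomes the line \<open>x = \<sigma> t\<close>, and a step function across this line satisfies
  \<open>w\<^sub>t + g\<^sub>x \<le> 0\<close> in the sense of distributions only if \<open>[g] \<le> \<sigma> [w]\<close>. For \<open>(w, g)\<close> equal to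
  the conserved quantities and their fluxes, with both signs, this is the Rankine-Hugoniot
  condition; for an entropy pair it is the entropy condition of the shock
  (\<open>jump_inequality_of_blow_up\<close>).

  The convergence is only known in \<open>L\<^sup>1\<close>, averaged over \<open>t0\<close> as well: the trace condition controls the
  part of the error away from the curve and the continuity of translations in \<open>L\<^sup>1\<close> the part along
  it (\<open>blow_up_L1\<close>). One sequence of scales therefore gives convergence almost everywhere
  for almost every \<open>t0\<close> (\<open>blow_up_sequence\<close>). The exceptional set of times depends on \<open>u\<close> and \<open>h\<close>
  alone, so that at every other time all the entropy pairs, an uncountable family, are dealt with
  at once.

  Two more ingredients are needed. The curve must be differentiable almost everywhere: this is
  Rademacher's theorem on the line, proved here with Vitali's covering theorem
  (\<open>lipschitz_AE_differentiable\<close>). And the entropy inequality of \<open>u\<close> is available only for pairs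
  with limits at vacuum if \<open>u\<close> takes the vacuum state, whereas a shock between nonvacuum
  states is tested with all pairs. For \<open>\<gamma> = 3\<close> these are the same pairs. In the Riemann invariants
  \<open>a = m / \<rho> + \<rho> / 2\<close> and \<open>b = m / \<rho> - \<rho> / 2\<close> the system is a pair of Burgers equations, every entropy is a
  function of \<open>a\<close> plus a function of \<open>b\<close>, and convexity down to vacuum forces the sum to
  be constant on the diagonal \<open>a = b\<close>, which is the vacuum (\<open>entropy_limits\<close>).
\<close>

section \<open>Differentiability of Lipschitz functions on the line\<close>

text \<open>
  By Vitali's theorem, disjoint intervals of slope at most \<open>r\<close>, lying in an open set that is barely
  larger than \<open>S\<close>, cover \<open>S\<close> up to a null set, and a Lipschitz map keeps that rest null. The statement
  is about a homeomorphism and its inverse so that it applies to both: a slope of \<open>f\<close> that is at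
  least \<open>q\<close> is a slope of the inverse of \<open>f\<close> that is at most \<open>1 / q\<close>.
\<close>

lemma emeasure_image_le_of_fine_cover:
  fixes g k :: "real \<Rightarrow> real"
  assumes mono: "strict_mono g" and lip: "L-lipschitz_on UNIV g" and k: "continuous_on UNIV k"
    and inv: "\<And>x. k (g x) = x" "\<And>y. g (k y) = y"
    and S: "S \<in> sets borel" and r: "0 \<le> r"
    and fine: "\<And>x d. x \<in> S \<Longrightarrow> 0 < d \<Longrightarrow> \<exists>a b. a \<le> x \<and> x \<le> b \<and> a < b \<and> b - a < d \<and> g b - g a \<le> r * (b - a)"
  shows "emeasure lborel (g ` S) \<le> ennreal r * emeasure lborel S"
proof (rule ennreal_le_epsilon)
  fix e :: real assume e: "0 < e"
  have cont: "continuous_on A g" for A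
    using lip by (meson continuous_on_subset lipschitz_on_continuous_on subset_UNIV)
  have image_eq: "g ` A = k -` A" for A
    using inv by (auto intro!: image_eqI[of _ g "k _"])
  have meas: "g ` A \<in> sets borel" if "A \<in> sets borel" for A
    unfolding image_eq using measurable_sets[OF borel_measurable_continuous_onI[OF k] that] by simp
  \<comment> \<open>The excess of the open set is chosen so that \<open>r * e' \<le> e\<close>, also when \<open>r = 0\<close>.\<close>
  define e' where "e' = e / (r + 1)"
  have e': "0 < e'" "r * e' \<le> e"
    using e r by (auto simp: e'_def field_simps)
  obtain O' where O': "open O'" "S \<subseteq> O'" "emeasure lebesgue (O' - S) < ennreal e'"
    using sets_lebesgue_outer_open[of S e'] S e' by (metis sets_completionI_sets sets_lborel)
  define I where "I = {(a, b). a < b \<and> {a..b} \<subseteq> O' \<and> g b - g a \<le> r * (b - a)}"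
  define c where "c = (\<lambda>(a::real, b). (a + b) / 2)"
  define \<rho> where "\<rho> = (\<lambda>(a::real, b). (b - a) / 2)"
  have ball: "cball (c i) (\<rho> i) = {fst i..snd i}" for i
  proof -
    obtain a b where i: "i = (a, b)"
      by fastforce
    have "(a + b) / 2 - (b - a) / 2 = a" "(a + b) / 2 + (b - a) / 2 = b"
      by (simp_all add: field_simps)
    then show ?thesis
      by (simp add: i c_def \<rho>_def cball_eq_atLeastAtMost)
  qed
  have fine': "\<exists>i. i \<in> I \<and> x \<in> cball (c i) (\<rho> i) \<and> \<rho> i < d" if xd: "x \<in> S" "0 < d" for x d
  proof -
    obtain \<delta> where \<delta>: "0 < \<delta>" "cball x \<delta> \<subseteq> O'"
      using open_contains_cball[of O'] O'(1) subsetD[OF O'(2) xd(1)] by auto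
    obtain a b where ab: "a \<le> x" "x \<le> b" "a < b" "b - a < min \<delta> d" "g b - g a \<le> r * (b - a)"
      using fine[OF xd(1), of "min \<delta> d"] \<open>0 < \<delta>\<close> xd(2) by auto
    have "{a..b} \<subseteq> cball x \<delta>"
      using ab by (auto simp: dist_real_def)
    then have "(a, b) \<in> I"
      using ab \<delta> by (auto simp: I_def)
    moreover have "\<rho> (a, b) < d"
      using ab by (simp add: \<rho>_def)
    ultimately show ?thesis
      using ab ball by (intro exI[of _ "(a, b)"]) auto
  qed
  have pos: "0 < \<rho> i" if "i \<in> I" for i
    using that by (auto simp: I_def \<rho>_def)
  obtain D where D: "countable D" "D \<subseteq> I"
    "pairwise (\<lambda>i j. disjnt (cball (c i) (\<rho> i)) (cball (c j) (\<rho> j))) D"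
    "negligible (S - (\<Union>i\<in>D. cball (c i) (\<rho> i)))"
    by (rule Vitali_covering_theorem_cballs[OF pos fine'])
  define J where "J = (\<lambda>i::real \<times> real. {fst i..snd i})"
  have disj: "disjoint_family_on J D"
    using D(3) by (auto simp: disjoint_family_on_def pairwise_def ball J_def disjnt_def)
  have J_le: "emeasure lborel (g ` J i) \<le> ennreal r * emeasure lborel (J i)" if "i \<in> D" for i
  proof -
    have "i \<in> I" using that D by blast
    then have i: "fst i < snd i" "g (snd i) - g (fst i) \<le> r * (snd i - fst i)"
      by (auto simp: I_def)
    have "g ` J i = {g (fst i)..g (snd i)}"
    proof
      show "g ` J i \<subseteq> {g (fst i)..g (snd i)}"
        using mono by (auto simp: J_def strict_mono_less_eq)
      show "{g (fst i)..g (snd i)} \<subseteq> g ` J i"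
        using IVT'[of g "fst i" _ "snd i"] i cont by (force simp: J_def)
    qed
    then have "emeasure lborel (g ` J i) = ennreal (g (snd i) - g (fst i))"
      using mono i by (simp add: strict_mono_less_eq)
    also have "\<dots> \<le> ennreal (r * (snd i - fst i))"
      using i by (simp add: ennreal_leI)
    also have "\<dots> = ennreal r * emeasure lborel (J i)"
      using i r by (simp add: J_def ennreal_mult)
    finally show ?thesis .
  qed
  have JS[measurable]: "J i \<in> sets borel" for i
    by (simp add: J_def)
  have UJ: "(\<Union>i\<in>D. J i) \<in> sets borel"
    using D(1) by auto
  have null: "emeasure lborel (g ` (S - (\<Union>i\<in>D. J i))) = 0"
  proof -
    have "negligible (g ` (S - (\<Union>i\<in>D. J i)))"
    proof (rule negligible_locally_Lipschitz_image)
      show "negligible (S - (\<Union>i\<in>D. J i))"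
        using D(4) by (simp add: J_def ball)
      show "\<exists>T B. open T \<and> x \<in> T \<and> (\<forall>y\<in>(S - (\<Union>i\<in>D. J i)) \<inter> T. norm (g y - g x) \<le> B * norm (y - x))" for x
        using lip by (intro exI[of _ UNIV] exI[of _ L]) (auto simp: lipschitz_on_def dist_norm)
    qed simp
    moreover have "g ` (S - (\<Union>i\<in>D. J i)) \<in> sets lborel"
      using meas S UJ by simp
    ultimately show ?thesis
      by (simp add: negligible_iff_null_sets null_sets_def)
  qed
  have "emeasure lborel (g ` S) \<le> emeasure lborel (g ` (\<Union>i\<in>D. J i) \<union> g ` (S - (\<Union>i\<in>D. J i)))"
    using meas S UJ by (intro emeasure_mono) auto
  also have "\<dots> \<le> emeasure lborel (g ` (\<Union>i\<in>D. J i)) + emeasure lborel (g ` (S - (\<Union>i\<in>D. J i)))"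
    using meas S UJ by (intro emeasure_subadditive) auto
  also have "\<dots> = emeasure lborel (\<Union>i\<in>D. g ` J i)"
    using null by (simp add: image_UN)
  also have "\<dots> = (\<integral>\<^sup>+i. emeasure lborel (g ` J i) \<partial>count_space D)"
  proof (rule emeasure_UN_countable)
    show "disjoint_family_on (\<lambda>i. g ` J i) D"
      using disj unfolding disjoint_family_on_def image_eq by blast
  qed (use meas D in auto)
  also have "\<dots> \<le> (\<integral>\<^sup>+i. ennreal r * emeasure lborel (J i) \<partial>count_space D)"
    using J_le by (intro nn_integral_mono) auto
  also have "\<dots> = ennreal r * emeasure lborel (\<Union>i\<in>D. J i)"
    using disj D(1) by (subst emeasure_UN_countable) (auto simp: nn_integral_cmult)
  also have "\<dots> \<le> ennreal r * emeasure lborel (S \<union> (O' - S))"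
  proof (intro mult_left_mono emeasure_mono)
    have "J i \<subseteq> O'" if "i \<in> D" for i
      using subsetD[OF D(2) that] by (cases i) (auto simp: I_def J_def)
    then show "(\<Union>i\<in>D. J i) \<subseteq> S \<union> (O' - S)"
      by blast
  qed (use S O' in auto)
  also have "\<dots> \<le> ennreal r * (emeasure lborel S + emeasure lborel (O' - S))"
    using S O' by (intro mult_left_mono emeasure_subadditive) auto
  also have "\<dots> \<le> ennreal r * (emeasure lborel S + ennreal e')"
  proof -
    have "emeasure lborel (O' - S) \<le> ennreal e'"
      using O' S by (simp add: emeasure_completion less_imp_le)
    then show ?thesis by (intro mult_left_mono add_left_mono) auto
  qed
  also have "\<dots> = ennreal r * emeasure lborel S + ennreal (r * e')"
    using r e' by (simp add: ennreal_mult distrib_left)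
  also have "\<dots> \<le> ennreal r * emeasure lborel S + ennreal e"
    using e' by (intro add_left_mono ennreal_leI)
  finally show "emeasure lborel (g ` S) \<le> ennreal r * emeasure lborel S + ennreal e" .
qed

text \<open>
  The limit is the supremum of the levels that eventually bound \<open>Q\<close> from below: a rational level
  strictly above it fails to do so, hence a slightly larger one bounds \<open>Q\<close> from above.
\<close>

lemma tendsto_if_no_oscillation:
  fixes Q :: "real \<Rightarrow> real"
  assumes nb: "F \<noteq> bot" and bd: "eventually (\<lambda>y. l \<le> Q y \<and> Q y \<le> u) F"
    and osc: "\<And>p q. p \<in> \<rat> \<Longrightarrow> q \<in> \<rat> \<Longrightarrow> p < q \<Longrightarrow> eventually (\<lambda>y. p \<le> Q y) F \<or> eventually (\<lambda>y. Q y \<le> q) F"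
  shows "\<exists>\<sigma>. (Q \<longlongrightarrow> \<sigma>) F"
proof -
  define A where "A = {p. eventually (\<lambda>y. p \<le> Q y) F}"
  define \<sigma> where "\<sigma> = Sup A"
  have ub: "p \<le> u" if "p \<in> A" for p
  proof -
    have "eventually (\<lambda>y. p \<le> u) F"
      using that bd unfolding A_def by (auto elim: eventually_elim2)
    then show ?thesis using nb by (simp add: eventually_const)
  qed
  then have bdd: "bdd_above A"
    by (rule bdd_aboveI)
  have ne: "l \<in> A"
    using bd by (auto simp: A_def elim: eventually_mono)
  have "(Q \<longlongrightarrow> \<sigma>) F"
  proof (rule order_tendstoI)
    fix a assume "a < \<sigma>"
    then obtain p where "p \<in> A" "a < p"
      using less_cSup_iff[OF _ bdd] ne unfolding \<sigma>_def by blast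
    then show "eventually (\<lambda>y. a < Q y) F"
      by (auto simp: A_def elim: eventually_mono)
  next
    fix a assume "\<sigma> < a"
    then obtain p where p: "p \<in> \<rat>" "\<sigma> < p" "p < a"
      using Rats_dense_in_real by blast
    obtain q where q: "q \<in> \<rat>" "p < q" "q < a"
      using Rats_dense_in_real p by blast
    have "p \<notin> A"
      using p cSup_upper[OF _ bdd] unfolding \<sigma>_def by fastforce
    then have "eventually (\<lambda>y. Q y \<le> q) F"
      using osc[of p q] p q by (auto simp: A_def)
    then show "eventually (\<lambda>y. Q y < a) F"
      using q by (auto elim: eventually_mono)
  qed
  then show ?thesis ..
qed

text \<open>
  The intervals straddle \<open>x\<close> strictly, which makes the set a countable intersection of open sets.
\<close>

definition steep_at :: "(real \<Rightarrow> real) \<Rightarrow> real \<Rightarrow> real set" where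
  "steep_at f q = {x. \<forall>n. \<exists>a b. a < x \<and> x < b \<and> b - a < 1 / real (Suc n) \<and> q * (b - a) < f b - f a}"

lemma steep_at_borel: "steep_at f q \<in> sets borel"
proof -
  have "steep_at f q = (\<Inter>n. \<Union>(a,b)\<in>{(a,b). b - a < 1 / real (Suc n) \<and> q * (b - a) < f b - f a}. {a<..<b})"
    by (fastforce simp: steep_at_def)
  also have "\<dots> \<in> sets borel"
    by (intro sets.countable_INT'' borel_open open_UN ballI) auto
  finally show ?thesis .
qed

lemma steep_atD:
  assumes "x \<in> steep_at f q" "0 < d"
  shows "\<exists>a b. a < x \<and> x < b \<and> b - a < d \<and> q * (b - a) < f b - f a"
proof -
  obtain n where "1 / real (Suc n) < d"
    using nat_approx_posE[OF assms(2)] by blast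
  then show ?thesis
    using assms(1) unfolding steep_at_def by (smt (verit, best) mem_Collect_eq)
qed

text \<open>
  Difference quotients at \<open>x\<close> belong to intervals with \<open>x\<close> as an endpoint; these are limits of
  straddling intervals because \<open>f\<close> is continuous.
\<close>

lemma not_steep_at:
  assumes "x \<notin> steep_at f q" and cont: "continuous_on UNIV f"
  shows "eventually (\<lambda>y. (f y - f x) / (y - x) \<le> q) (at x)"
proof -
  obtain n where n: "\<And>a b. a < x \<Longrightarrow> x < b \<Longrightarrow> b - a < 1 / real (Suc n) \<Longrightarrow> f b - f a \<le> q * (b - a)"
    using assms(1) unfolding steep_at_def by (force simp: not_less)
  define d where "d = 1 / real (Suc n)"
  have d: "0 < d" by (simp add: d_def)
  have tl: "(f \<longlongrightarrow> f x) (at x within A)" for A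
    using cont by (metis UNIV_I continuous_on_def tendsto_within_subset top_greatest)
  have R: "f y - f x \<le> q * (y - x)" if y: "x < y" "y < x + d" for y
  proof (rule tendsto_le[of "at_left x"])
    show "((\<lambda>a. q * (y - a)) \<longlongrightarrow> q * (y - x)) (at_left x)"
      by (intro tendsto_intros)
    show "((\<lambda>a. f y - f a) \<longlongrightarrow> f y - f x) (at_left x)"
      by (intro tendsto_intros tl)
    show "eventually (\<lambda>a. f y - f a \<le> q * (y - a)) (at_left x)"
      unfolding eventually_at_left_field
      using y n by (intro exI[of _ "y - d"]) (auto simp: d_def)
  qed simp
  have L: "f x - f y \<le> q * (x - y)" if y: "y < x" "x < y + d" for y
  proof (rule tendsto_le[of "at_right x"])
    show "((\<lambda>a. q * (a - y)) \<longlongrightarrow> q * (x - y)) (at_right x)"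
      by (intro tendsto_intros)
    show "((\<lambda>a. f a - f y) \<longlongrightarrow> f x - f y) (at_right x)"
      by (intro tendsto_intros tl)
    show "eventually (\<lambda>a. f a - f y \<le> q * (a - y)) (at_right x)"
      unfolding eventually_at_right_field
      using y n by (intro exI[of _ "y + d"]) (auto simp: d_def)
  qed simp
  show ?thesis
    unfolding eventually_at
  proof (intro exI[of _ d] conjI ballI impI d)
    fix y assume y: "y \<noteq> x \<and> dist y x < d"
    show "(f y - f x) / (y - x) \<le> q"
    proof (cases "x < y")
      case True
      then show ?thesis using R[of y] y by (simp add: dist_real_def pos_divide_le_eq)
    next
      case False
      then have "y < x" using y by simp
      moreover have "(f y - f x) / (y - x) = (f x - f y) / (x - y)"
        by (metis minus_diff_eq minus_divide_divide)
      ultimately show ?thesis using L[of y] y by (simp add: dist_real_def pos_divide_le_eq)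
    qed
  qed
qed

text \<open>
  Let \<open>E\<close> be a bounded part of the set where \<open>f x = h x + (C + 1) * x\<close> has, at arbitrarily small
  scales, slopes below \<open>p\<close> as well as slopes above \<open>q\<close>, with \<open>p < q\<close>. The covering lemma bounds the
  measure of \<open>f ` E\<close> by \<open>p\<close> times that of \<open>E\<close>, and, applied to the inverse of \<open>f\<close>, the measure
  of \<open>E\<close> by \<open>1 / q\<close> times that of \<open>f ` E\<close>. So \<open>E\<close> is a null set, and off countably many such sets
  the difference quotients do not oscillate.
\<close>

lemma lipschitz_AE_differentiable:
  fixes h :: "real \<Rightarrow> real"
  assumes lip: "C-lipschitz_on UNIV h"
  shows "AE x in lborel. \<exists>\<sigma>. (h has_real_derivative \<sigma>) (at x)"
proof -
  have C: "0 \<le> C" using lip lipschitz_on_nonneg by blast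
  have hb: "\<bar>h y - h x\<bar> \<le> C * \<bar>y - x\<bar>" for x y
    using lipschitz_onD[OF lip, of y x] by (simp add: dist_real_def)
  \<comment> \<open>The added slope makes \<open>f\<close> bi-Lipschitz, with all slopes between \<open>1\<close> and \<open>2 * C + 1\<close>.\<close>
  define f where "f = (\<lambda>x. h x + (C + 1) * x)"
  have lo: "y - x \<le> f y - f x" and up: "f y - f x \<le> (2 * C + 1) * (y - x)" if "x \<le> y" for x y
    using hb[of y x] that C by (auto simp: f_def algebra_simps)
  have sm: "strict_mono f"
    using lo by (smt (verit) strict_monoI)
  have flip: "(2 * C + 1)-lipschitz_on UNIV f"
  proof (rule lipschitz_onI)
    show "dist (f x) (f y) \<le> (2 * C + 1) * dist x y" for x y
      using lo[of x y] up[of x y] lo[of y x] up[of y x] by (cases "x \<le> y") (auto simp: dist_real_def)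
  qed (use C in auto)
  have fcont: "continuous_on UNIV f"
    using flip lipschitz_on_continuous_on by blast
  have "surj f"
  proof (unfold surj_def, rule allI)
    fix y
    define a where "a = - \<bar>y - f 0\<bar>"
    define b where "b = \<bar>y - f 0\<bar>"
    have "f a \<le> y" "y \<le> f b" "a \<le> b"
      using lo[of a 0] lo[of 0 b] by (auto simp: a_def b_def)
    then show "\<exists>x. y = f x"
      using IVT'[of f a y b] fcont by (metis continuous_on_subset subset_UNIV)
  qed
  define k where "k = inv f"
  have inv: "k (f x) = x" "f (k y) = y" for x y
    using \<open>surj f\<close> strict_mono_imp_inj_on[OF sm] by (simp_all add: k_def surj_f_inv_f)
  have kmono: "strict_mono k"
    by (metis inv(2) sm strict_mono_def strict_mono_less)
  have klip: "1-lipschitz_on UNIV k"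
  proof (rule lipschitz_onI)
    show "dist (k x) (k y) \<le> 1 * dist x y" for x y
      using lo[of "k x" "k y"] lo[of "k y" "k x"] inv(2)[of x] inv(2)[of y]
      by (cases "k x \<le> k y") (auto simp: dist_real_def)
  qed simp
  have kcont: "continuous_on UNIV k"
    using klip lipschitz_on_continuous_on by blast
  have null: "AE x in lborel. \<not> (x \<in> steep_at (\<lambda>x. - f x) (- p) \<and> x \<in> steep_at f q)" if "p < q" for p q
  proof -
    define E where "E = (\<lambda>n::nat. steep_at (\<lambda>x. - f x) (- p) \<inter> steep_at f q \<inter> {- real n..real n})"
    have E[measurable]: "E n \<in> sets borel" for n
      unfolding E_def by (intro sets.Int steep_at_borel) auto
    have "emeasure lborel (E n) = 0" for n
    proof (cases "E n = {}")
      case False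
      then obtain x where x: "x \<in> E n" by blast
      have pE: "\<exists>a b. a \<le> x \<and> x \<le> b \<and> a < b \<and> b - a < d \<and> f b - f a \<le> p * (b - a)"
        if "x \<in> E n" "0 < d" for x d
      proof -
        have "x \<in> steep_at (\<lambda>x. - f x) (- p)"
          using that by (simp add: E_def)
        from steep_atD[OF this \<open>0 < d\<close>] obtain a b
          where "a < x" "x < b" "b - a < d" "- p * (b - a) < - f b - - f a"
          by blast
        then show ?thesis
          by (intro exI[of _ a] exI[of _ b]) auto
      qed
      have qE: "\<exists>a b. a \<le> x \<and> x \<le> b \<and> a < b \<and> b - a < d \<and> q * (b - a) \<le> f b - f a"
        if "x \<in> E n" "0 < d" for x d
      proof -
        have "x \<in> steep_at f q"
          using that by (simp add: E_def)
        from steep_atD[OF this \<open>0 < d\<close>] obtain a b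
          where "a < x" "x < b" "b - a < d" "q * (b - a) < f b - f a"
          by blast
        then show ?thesis
          by (intro exI[of _ a] exI[of _ b]) auto
      qed
      have p0: "0 < p"
      proof -
        obtain a b where ab: "a < b" "f b - f a \<le> p * (b - a)"
          using pE[OF x zero_less_one] by blast
        have "0 < f b - f a"
          using ab lo[of a b] by simp
        then show ?thesis
          using ab zero_less_mult_pos2[of p "b - a"] by linarith
      qed
      have 1: "emeasure lborel (f ` E n) \<le> ennreal p * emeasure lborel (E n)"
        using pE p0 by (intro emeasure_image_le_of_fine_cover[OF sm flip kcont inv]) auto
      have fE: "f ` E n \<in> sets borel"
      proof -
        have "f ` E n = k -` E n" using inv by (auto intro!: image_eqI[of _ f "k _"])
        then show ?thesis
          using measurable_sets[OF borel_measurable_continuous_onI[OF kcont] E] by simp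
      qed
      have "emeasure lborel (k ` f ` E n) \<le> ennreal (1 / q) * emeasure lborel (f ` E n)"
      proof (rule emeasure_image_le_of_fine_cover[OF kmono klip fcont inv(2,1) fE])
        fix z d assume z: "z \<in> f ` E n" and d: "(0::real) < d"
        then obtain x where x: "x \<in> E n" "z = f x" by blast
        obtain a b where ab: "a \<le> x" "x \<le> b" "a < b" "b - a < d / (2 * C + 1)" "q * (b - a) \<le> f b - f a"
          using qE[OF x(1), of "d / (2 * C + 1)"] d C by auto
        have "f b - f a < d"
          using up[of a b] ab C by (simp add: less_divide_eq mult.commute)
        moreover have "f a \<le> z" "z \<le> f b" "f a < f b"
          using ab x sm by (auto simp: strict_mono_less_eq strict_mono_less)
        moreover have "k (f b) - k (f a) \<le> 1 / q * (f b - f a)"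
          using ab p0 \<open>p < q\<close> by (simp add: inv le_divide_eq mult.commute)
        ultimately show "\<exists>a b. a \<le> z \<and> z \<le> b \<and> a < b \<and> b - a < d \<and> k b - k a \<le> 1 / q * (b - a)"
          by blast
      qed (use p0 \<open>p < q\<close> in auto)
      also have "\<dots> \<le> ennreal (1 / q) * (ennreal p * emeasure lborel (E n))"
        using 1 by (intro mult_left_mono) auto
      also have "\<dots> = ennreal (p / q) * emeasure lborel (E n)"
        using p0 \<open>p < q\<close> by (simp add: mult.assoc[symmetric] ennreal_mult[symmetric])
      finally have 2: "emeasure lborel (E n) \<le> ennreal (p / q) * emeasure lborel (E n)"
        using inv by (simp add: image_image)
      have fin: "emeasure lborel (E n) < \<infinity>"
      proof -
        have "emeasure lborel (E n) \<le> emeasure lborel {- real n..real n}"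
          by (intro emeasure_mono) (auto simp: E_def)
        then show ?thesis by (simp add: le_less_trans)
      qed
      then obtain m where m: "0 \<le> m" "emeasure lborel (E n) = ennreal m"
        by (cases "emeasure lborel (E n)") auto
      have "m \<le> (p / q) * m"
        using 2 m p0 \<open>p < q\<close> by (simp add: ennreal_mult[symmetric])
      moreover have "p / q < 1" using p0 \<open>p < q\<close> by simp
      ultimately have "m = 0"
        using m(1) mult_strict_right_mono[of "p / q" 1 m] by force
      then show ?thesis using m by simp
    qed simp
    then have "AE x in lborel. \<forall>n. x \<notin> E n"
      by (subst AE_all_countable) (auto intro!: AE_not_in simp: null_sets_def)
    then show ?thesis
    proof eventually_elim
      case (elim x)
      obtain n where "\<bar>x\<bar> \<le> real n" using real_arch_simple by blast
      then show ?case using elim[rule_format, of n] by (auto simp: E_def)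
    qed
  qed
  have "AE x in lborel. \<forall>p\<in>\<rat>. \<forall>q\<in>\<rat>. p < q \<longrightarrow> \<not> (x \<in> steep_at (\<lambda>x. - f x) (- p) \<and> x \<in> steep_at f q)"
  proof (intro AE_ball_countable' countable_rat)
    show "AE x in lborel. p < q \<longrightarrow> \<not> (x \<in> steep_at (\<lambda>x. - f x) (- p) \<and> x \<in> steep_at f q)" for p q
      using null[of p q] by (cases "p < q") auto
  qed
  then show ?thesis
  proof eventually_elim
    case (elim x)
    have "\<exists>\<sigma>. ((\<lambda>y. (f y - f x) / (y - x)) \<longlongrightarrow> \<sigma>) (at x)"
    proof (rule tendsto_if_no_oscillation[where l = 1 and u = "2 * C + 1"])
      show "eventually (\<lambda>y. 1 \<le> (f y - f x) / (y - x) \<and> (f y - f x) / (y - x) \<le> 2 * C + 1) (at x)"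
        unfolding eventually_at
      proof (intro exI[of _ 1] conjI ballI impI)
        fix y assume y: "y \<noteq> x \<and> dist y x < 1"
        have quotient: "1 \<le> (f b - f a) / (b - a)" "(f b - f a) / (b - a) \<le> 2 * C + 1" if "a < b" for a b
          using lo[of a b] up[of a b] that by (simp_all add: le_divide_eq divide_le_eq)
        have "(f y - f x) / (y - x) = (f x - f y) / (x - y)"
          by (metis minus_diff_eq minus_divide_divide)
        then show "1 \<le> (f y - f x) / (y - x)" "(f y - f x) / (y - x) \<le> 2 * C + 1"
          using quotient[of x y] quotient[of y x] y by (metis linorder_neqE)+
      qed simp
      show "eventually (\<lambda>y. p \<le> (f y - f x) / (y - x)) (at x) \<or> eventually (\<lambda>y. (f y - f x) / (y - x) \<le> q) (at x)"
        if pq: "p \<in> \<rat>" "q \<in> \<rat>" "p < q" for p q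
      proof -
        consider "x \<notin> steep_at (\<lambda>x. - f x) (- p)" | "x \<notin> steep_at f q"
          using elim pq by blast
        then show ?thesis
        proof cases
          case 1
          have "eventually (\<lambda>y. (- f y - - f x) / (y - x) \<le> - p) (at x)"
            by (rule not_steep_at[OF 1]) (intro continuous_intros fcont)
          then have "eventually (\<lambda>y. p \<le> (f y - f x) / (y - x)) (at x)"
            by (rule eventually_mono) (simp add: diff_divide_distrib)
          then show ?thesis ..
        next
          case 2
          then show ?thesis using not_steep_at[OF 2 fcont] by blast
        qed
      qed
    qed simp
    then obtain \<sigma> where "(f has_real_derivative \<sigma>) (at x)"
      by (auto simp: has_field_derivative_iff)
    then have "((\<lambda>x. f x - (C + 1) * x) has_real_derivative \<sigma> - (C + 1)) (at x)"
      by (auto intro!: derivative_eq_intros)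
    then show ?case
      by (auto simp: f_def)
  qed
qed

section \<open>Entropies at vacuum\<close>

text \<open>
  \<open>H\<close> and \<open>K\<close> are \<open>\<eta>\<close> and \<open>q\<close> as functions of the Riemann invariants \<open>b < a\<close>, in which \<open>q' = \<eta>' f'\<close> says
  that the partial derivatives of \<open>K\<close> are those of \<open>H\<close> times \<open>a\<close> and \<open>b\<close>. For smooth functions,
  equating the two mixed second derivatives of \<open>K\<close> gives \<open>(a - b) * H\<^sub>a\<^sub>b = 0\<close>, so \<open>H\<close> is a function of
  \<open>a\<close> plus a function of \<open>b\<close>. Only first derivatives exist here, and the argument has to be
  carried out with differences.
\<close>

locale riemann_invariant_pair =
  fixes H K Ha Hb :: "real \<Rightarrow> real \<Rightarrow> real"
  assumes cont: "continuous_on {(a, b). b < a} (\<lambda>(a, b). H a b)"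
    and H1: "\<And>a b. b < a \<Longrightarrow> ((\<lambda>a. H a b) has_real_derivative Ha a b) (at a)"
    and H2: "\<And>a b. b < a \<Longrightarrow> ((\<lambda>b. H a b) has_real_derivative Hb a b) (at b)"
    and K1: "\<And>a b. b < a \<Longrightarrow> ((\<lambda>a. K a b) has_real_derivative a * Ha a b) (at a)"
    and K2: "\<And>a b. b < a \<Longrightarrow> ((\<lambda>b. K a b) has_real_derivative b * Hb a b) (at b)"
begin

text \<open>
  The mixed differences \<open>M\<close> of \<open>H\<close> and \<open>N\<close> of \<open>K\<close> vanish when \<open>a = x\<close> or \<open>b = y\<close>, and \<open>a * M - N\<close> has
  derivative \<open>M\<close> in \<open>a\<close>, \<open>b * M - N\<close> has derivative \<open>M\<close> in \<open>b\<close>. On a square of radius \<open>r\<close> both are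
  therefore bounded by \<open>r\<close> times the maximum of \<open>\<bar>M\<bar>\<close>, and so their difference \<open>(a - b) * M\<close> by \<open>2 * r\<close>
  times it. As \<open>a - b \<ge> 6 * r\<close> there, the maximum is \<open>0\<close>.
\<close>

lemma mixed_difference_local:
  assumes "y < x" and r: "r = (x - y) / 8" and a: "\<bar>a - x\<bar> \<le> r" and b: "\<bar>b - y\<bar> \<le> r"
  shows "H a b - H x b = H a y - H x y"
proof -
  define M where "M = (\<lambda>a b. H a b - H x b - H a y + H x y)"
  define N where "N = (\<lambda>a b. K a b - K x b - K a y + K x y)"
  define A where "A = {x - r..x + r}"
  define B where "B = {y - r..y + r}"
  have r0: "0 < r" and r8: "x = y + 8 * r" using assms by simp_all
  have gap: "6 * r \<le> a - b" if "a \<in> A" "b \<in> B" for a b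
    using that r8 by (auto simp: A_def B_def)
  have lt: "b < a" if "a \<in> A" "b \<in> B" for a b
    using gap[OF that] r0 by linarith
  have xy: "x \<in> A" "y \<in> B" using r0 by (auto simp: A_def B_def)
  have contH: "continuous_on S (\<lambda>z. H (f z) (g z))"
    if "continuous_on S f" "continuous_on S g" "\<And>z. z \<in> S \<Longrightarrow> g z < f z" for S :: "(real \<times> real) set" and f g
  proof -
    have "continuous_on S (\<lambda>z. (\<lambda>(a, b). H a b) (f z, g z))"
      using that by (intro continuous_on_compose2[OF cont] continuous_on_Pair) auto
    then show ?thesis by simp
  qed
  have contM: "continuous_on (A \<times> B) (\<lambda>z. \<bar>M (fst z) (snd z)\<bar>)"
    unfolding M_def using lt xy
    by (intro continuous_intros contH) auto
  have square: "compact (A \<times> B)" "A \<times> B \<noteq> {}"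
    using xy by (auto simp: A_def B_def intro: compact_Times)
  obtain p where p: "p \<in> A \<times> B" "\<And>z. z \<in> A \<times> B \<Longrightarrow> \<bar>M (fst z) (snd z)\<bar> \<le> \<bar>M (fst p) (snd p)\<bar>"
    using continuous_attains_sup[OF square contM] by blast
  define m where "m = \<bar>M (fst p) (snd p)\<bar>"
  have m: "\<bar>M a b\<bar> \<le> m" if "a \<in> A" "b \<in> B" for a b
    using p(2)[of "(a, b)"] that by (simp add: m_def)
  have bound1: "\<bar>a * M a b - N a b\<bar> \<le> m * r" if ab: "a \<in> A" "b \<in> B" for a b
  proof -
    have "norm ((a * M a b - N a b) - (x * M x b - N x b)) \<le> m * norm (a - x)"
    proof (rule field_differentiable_bound[of A "\<lambda>a. a * M a b - N a b" "\<lambda>a. M a b"])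
      show "((\<lambda>a. a * M a b - N a b) has_field_derivative M a b) (at a within A)" if "a \<in> A" for a
        unfolding M_def N_def using lt[OF that ab(2)] lt[OF that xy(2)]
        by (auto intro!: derivative_eq_intros DERIV_subset[OF H1] DERIV_subset[OF K1] simp: algebra_simps)
    qed (use m ab xy in \<open>auto simp: A_def\<close>)
    moreover have "x * M x b - N x b = 0" by (simp add: M_def N_def)
    moreover have "m * \<bar>a - x\<bar> \<le> m * r"
      using ab by (intro mult_left_mono) (auto simp: A_def m_def)
    ultimately show ?thesis by simp
  qed
  have bound2: "\<bar>b * M a b - N a b\<bar> \<le> m * r" if ab: "a \<in> A" "b \<in> B" for a b
  proof -
    have "norm ((b * M a b - N a b) - (y * M a y - N a y)) \<le> m * norm (b - y)"
    proof (rule field_differentiable_bound[of B "\<lambda>b. b * M a b - N a b" "\<lambda>b. M a b"])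
      show "((\<lambda>b. b * M a b - N a b) has_field_derivative M a b) (at b within B)" if "b \<in> B" for b
        unfolding M_def N_def using lt[OF ab(1) that] lt[OF xy(1) that]
        by (auto intro!: derivative_eq_intros DERIV_subset[OF H2] DERIV_subset[OF K2] simp: algebra_simps)
    qed (use m ab xy in \<open>auto simp: B_def\<close>)
    moreover have "y * M a y - N a y = 0" by (simp add: M_def N_def)
    moreover have "m * \<bar>b - y\<bar> \<le> m * r"
      using ab by (intro mult_left_mono) (auto simp: B_def m_def)
    ultimately show ?thesis by simp
  qed
  have "m = 0"
  proof -
    obtain a b where ab: "p = (a, b)" "a \<in> A" "b \<in> B" using p(1) by auto
    have "6 * r * m \<le> (a - b) * m"
      using gap[OF ab(2,3)] by (intro mult_right_mono) (auto simp: m_def)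
    also have "\<dots> = \<bar>(a - b) * M a b\<bar>"
      using lt[OF ab(2,3)] ab(1) by (simp add: m_def abs_mult)
    also have "\<dots> = \<bar>(a * M a b - N a b) - (b * M a b - N a b)\<bar>"
      by (simp add: algebra_simps)
    also have "\<dots> \<le> 2 * r * m"
      using bound1[OF ab(2,3)] bound2[OF ab(2,3)] by (simp add: algebra_simps)
    finally have "r * m \<le> 0" by (simp add: mult.commute)
    then show ?thesis
      using r0 by (simp add: m_def mult_le_0_iff)
  qed
  then have "M a b = 0"
    using m[of a b] a b by (auto simp: A_def B_def abs_le_iff)
  then show ?thesis by (simp add: M_def)
qed

text \<open>
  The local statement makes the derivative of \<open>H\<close> in \<open>a\<close> locally constant in \<open>b\<close>, and \<open>b\<close> ranges over
  an interval.
\<close>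

lemma Ha_independent:
  assumes "b < a" "b' < a"
  shows "Ha a b = Ha a b'"
proof -
  have "((\<lambda>b. Ha a b) has_field_derivative 0) (at y within {..<a})" if y: "y \<in> {..<a}" for y
  proof -
    define r where "r = (a - y) / 8"
    have r0: "0 < r" using y by (simp add: r_def)
    have eq: "Ha a b = Ha a y" if b: "b \<in> {y - r<..<y + r}" for b
    proof -
      have ba: "b < a" "y < a" using b y by (auto simp: r_def field_simps)
      have "((\<lambda>a'. H a' b - H a' y) has_real_derivative (Ha a b - Ha a y)) (at a)"
        using ba by (intro derivative_intros H1)
      moreover have "((\<lambda>a'. H a' b - H a' y) has_real_derivative 0) (at a)"
      proof (rule has_field_derivative_transform_within_open)
        show "((\<lambda>_. H a b - H a y) has_real_derivative 0) (at a)" by simp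
        show "open {a - r<..<a + r}" "a \<in> {a - r<..<a + r}" using r0 by auto
        show "H a b - H a y = H x b - H x y" if "x \<in> {a - r<..<a + r}" for x
          using mixed_difference_local[OF ba(2) r_def, of x b] that b by (auto simp: abs_le_iff)
      qed
      ultimately show ?thesis using DERIV_unique by fastforce
    qed
    have "((\<lambda>b. Ha a b) has_field_derivative 0) (at y)"
    proof (rule has_field_derivative_transform_within_open)
      show "((\<lambda>_. Ha a y) has_real_derivative 0) (at y)" by simp
      show "open {y - r<..<y + r}" "y \<in> {y - r<..<y + r}" using r0 by auto
      show "Ha a y = Ha a b" if "b \<in> {y - r<..<y + r}" for b
        using eq[OF that] by (rule sym)
    qed
    then show ?thesis by (rule DERIV_subset) simp
  qed
  then obtain c where "\<forall>b\<in>{..<a}. Ha a b = c"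
    using has_field_derivative_zero_constant[of "{..<a}" "\<lambda>b. Ha a b"] by auto
  then show ?thesis using assms by simp
qed

lemma rectangle:
  assumes "b < a" "b' < a" "b < a'" "b' < a'"
  shows "H a b + H a' b' = H a b' + H a' b" "K a b + K a' b' = K a b' + K a' b"
proof -
  define m where "m = max b b'"
  have "((\<lambda>a. H a b - H a b') has_field_derivative 0) (at x within {m<..})"
       "((\<lambda>a. K a b - K a b') has_field_derivative 0) (at x within {m<..})" if "x \<in> {m<..}" for x
  proof -
    have x: "b < x" "b' < x" using that by (auto simp: m_def)
    show "((\<lambda>a. H a b - H a b') has_field_derivative 0) (at x within {m<..})"
      using Ha_independent[OF x] x
      by (auto intro!: derivative_eq_intros DERIV_subset[OF H1])
    show "((\<lambda>a. K a b - K a b') has_field_derivative 0) (at x within {m<..})"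
      using Ha_independent[OF x] x
      by (auto intro!: derivative_eq_intros DERIV_subset[OF K1])
  qed
  then have "\<exists>c. \<forall>x\<in>{m<..}. H x b - H x b' = c" "\<exists>c. \<forall>x\<in>{m<..}. K x b - K x b' = c"
    by (intro has_field_derivative_zero_constant; simp)+
  moreover have "a \<in> {m<..}" "a' \<in> {m<..}" using assms by (auto simp: m_def)
  ultimately have "H a b - H a b' = H a' b - H a' b'" "K a b - K a b' = K a' b - K a' b'"
    by metis+
  then show "H a b + H a' b' = H a b' + H a' b" "K a b + K a' b' = K a b' + K a' b"
    by linarith+
qed

end

text \<open>
  Near vacuum both Riemann invariants differ from the velocity by \<open>\<rho> / 2\<close>, and the velocities form a
  compact interval on which \<open>P\<close> and \<open>Q\<close> are uniformly continuous.
\<close>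

lemma tendsto_vacuum:
  fixes P Q :: "real \<Rightarrow> real" and g :: "real \<times> real \<Rightarrow> real"
  assumes M: "0 \<le> M"
    and P: "continuous_on {-M - 1<..<M + 1} P" and Q: "continuous_on {-M - 1<..<M + 1} Q"
    and L: "\<And>v. v \<in> {-M - 1<..<M + 1} \<Longrightarrow> P v + Q v = L"
    and g: "\<And>\<rho> m. 0 < \<rho> \<Longrightarrow> \<rho> < 1 \<Longrightarrow> \<bar>m\<bar> \<le> M * \<rho> \<Longrightarrow> g (\<rho>, m) = P (m / \<rho> + \<rho> / 2) + Q (m / \<rho> - \<rho> / 2)"
  shows "(g \<longlongrightarrow> L) (at (0, 0) within {(\<rho>, m). 0 < \<rho> \<and> \<bar>m\<bar> \<le> M * \<rho>})"
proof (rule tendstoI)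
  fix e :: real assume e: "0 < e"
  define I where "I = {-M - 1/2..M + 1/2}"
  have sub: "I \<subseteq> {-M - 1<..<M + 1}" by (auto simp: I_def)
  have "uniformly_continuous_on I P" "uniformly_continuous_on I Q"
    using continuous_on_subset[OF P sub] continuous_on_subset[OF Q sub]
    by (auto simp: I_def intro: compact_uniformly_continuous)
  then obtain d1 d2 where d1: "0 < d1" "\<And>x y. x \<in> I \<Longrightarrow> y \<in> I \<Longrightarrow> dist x y < d1 \<Longrightarrow> dist (P x) (P y) < e / 2"
    and d2: "0 < d2" "\<And>x y. x \<in> I \<Longrightarrow> y \<in> I \<Longrightarrow> dist x y < d2 \<Longrightarrow> dist (Q x) (Q y) < e / 2"
    using e unfolding uniformly_continuous_on_def by (metis half_gt_zero)
  define d where "d = min 1 (min d1 d2)"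
  show "\<forall>\<^sub>F z in at (0, 0) within {(\<rho>, m). 0 < \<rho> \<and> \<bar>m\<bar> \<le> M * \<rho>}. dist (g z) L < e"
    unfolding eventually_at
  proof (intro exI[of _ d] conjI ballI impI)
    show "0 < d" using d1 d2 by (simp add: d_def)
    fix z assume "z \<in> {(\<rho>, m). 0 < \<rho> \<and> \<bar>m\<bar> \<le> M * \<rho>}" and dist: "z \<noteq> (0, 0) \<and> dist z (0, 0) < d"
    then obtain \<rho> m where z: "z = (\<rho>, m)" "0 < \<rho>" "\<bar>m\<bar> \<le> M * \<rho>" by auto
    have "\<bar>\<rho>\<bar> \<le> dist z (0, 0)"
      using dist_fst_le[of z "(0, 0)"] by (simp add: z dist_real_def)
    then have \<rho>: "\<rho> < d" using dist[THEN conjunct2] by linarith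
    define v where "v = m / \<rho>"
    have v: "\<bar>v\<bar> \<le> M" using z by (simp add: v_def abs_divide divide_le_eq)
    have I: "v \<in> I" "v + \<rho> / 2 \<in> I" "v - \<rho> / 2 \<in> I"
      using v \<rho> z(2) by (auto simp: I_def d_def abs_le_iff)
    have "dist (P (v + \<rho> / 2)) (P v) < e / 2" "dist (Q (v - \<rho> / 2)) (Q v) < e / 2"
      using \<rho> z(2) d1(2)[OF I(2,1)] d2(2)[OF I(3,1)] by (simp_all add: dist_real_def d_def)
    moreover have "g z = P (v + \<rho> / 2) + Q (v - \<rho> / 2)"
      using g[of \<rho> m] z \<rho> by (simp add: v_def d_def)
    moreover have "P v + Q v = L" using L I sub by blast
    ultimately show "dist (g z) L < e"
      unfolding dist_real_def by linarith
  qed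
qed

lemma open_nonvacuum: "open nonvacuum"
proof -
  have "nonvacuum = {0<..} \<times> UNIV" by (auto simp: nonvacuum_def)
  then show ?thesis using open_Times[OF open_greaterThan open_UNIV] by metis
qed

lemma velocity_bounds:
  fixes M :: real
  assumes "0 < \<rho>" "\<rho> < 1" "\<bar>m\<bar> \<le> M * \<rho>"
  shows "m / \<rho> + \<rho> / 2 \<in> {-M - 1<..<M + 1}" "m / \<rho> - \<rho> / 2 \<in> {-M - 1<..<M + 1}"
proof -
  define v where "v = m / \<rho>"
  have "\<bar>v\<bar> \<le> M" using assms by (simp add: v_def abs_divide divide_le_eq)
  then have "v + \<rho> / 2 \<in> {-M - 1<..<M + 1}" "v - \<rho> / 2 \<in> {-M - 1<..<M + 1}"
    using assms(1,2) by (auto simp: abs_le_iff)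
  then show "m / \<rho> + \<rho> / 2 \<in> {-M - 1<..<M + 1}" "m / \<rho> - \<rho> / 2 \<in> {-M - 1<..<M + 1}"
    by (simp_all add: v_def)
qed

text \<open>
  Splitting \<open>\<eta>\<close> into a function of each Riemann invariant shows that it tends to some \<open>c v\<close> as the
  density tends to \<open>0\<close> at velocity \<open>v\<close>, and \<open>q\<close> to some \<open>k v\<close>. Convexity makes \<open>c\<close> constant: a state of
  small density and velocity \<open>v\<close> is a convex combination, with small weight on the first, of
  \<open>(1, v)\<close> and of a state arbitrarily close to vacuum with velocity \<open>w\<close>, whence \<open>c v \<le> c w\<close>.
  Then \<open>k\<close> is constant because its derivative is \<open>v\<close> times that of \<open>c\<close>.
\<close>

lemma entropy_limits:
  assumes ent: "entropy_pair \<eta> q"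
  shows "\<exists>L N. \<forall>M. (\<eta> \<longlongrightarrow> L) (at (0, 0) within {(\<rho>, m). 0 < \<rho> \<and> \<bar>m\<bar> \<le> M * \<rho>}) \<and>
           (q \<longlongrightarrow> N) (at (0, 0) within {(\<rho>, m). 0 < \<rho> \<and> \<bar>m\<bar> \<le> M * \<rho>})"
proof -
  define c :: "real \<Rightarrow> real \<Rightarrow> real \<times> real" where "c = (\<lambda>a b. (a - b, (a\<^sup>2 - b\<^sup>2) / 2))"
  define H where "H = (\<lambda>a b. \<eta> (c a b))"
  define K where "K = (\<lambda>a b. q (c a b))"
  from ent obtain D\<eta> Df where D: "\<And>v. v \<in> nonvacuum \<Longrightarrow> (\<eta> has_derivative D\<eta> v) (at v) \<and>
      (flux has_derivative Df v) (at v) \<and> (q has_derivative (D\<eta> v \<circ> Df v)) (at v)"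
    unfolding entropy_pair_def by metis
  have c_nv: "c a b \<in> nonvacuum" if "b < a" for a b
    using that by (simp add: c_def nonvacuum_def)
  have flux_c: "flux (c a b) = ((a\<^sup>2 - b\<^sup>2) / 2, (a ^ 3 - b ^ 3) / 3)" if "b < a" for a b
  proof -
    have m: "(a\<^sup>2 - b\<^sup>2) / 2 = (a - b) * ((a + b) / 2)"
      by (simp add: power2_eq_square algebra_simps)
    have "((a\<^sup>2 - b\<^sup>2) / 2)\<^sup>2 / (a - b) = (a - b) * ((a + b) / 2)\<^sup>2"
    proof -
      have "(s * w)\<^sup>2 / s = s * w\<^sup>2" if "s \<noteq> 0" for s w :: real
        using that by (simp add: power2_eq_square)
      then show ?thesis unfolding m by this (use that in simp)
    qed
    moreover have "(a - b) * ((a + b) / 2)\<^sup>2 + (a - b) ^ 3 / 12 = (a ^ 3 - b ^ 3) / 3"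
      by (simp add: power2_eq_square power3_eq_cube field_simps)
    ultimately show ?thesis
      by (simp add: flux_def c_def)
  qed
  have ca: "((\<lambda>a. c a b) has_derivative (\<lambda>h. h *\<^sub>R (1, a))) (at a)" for a b
    unfolding c_def by (auto intro!: derivative_eq_intros)
  have cb: "((\<lambda>b. c a b) has_derivative (\<lambda>h. h *\<^sub>R (-1, -b))) (at b)" for a b
    unfolding c_def by (auto intro!: derivative_eq_intros)
  have lin: "linear (D\<eta> v)" "linear (Df v)" if "v \<in> nonvacuum" for v
    using D[OF that] has_derivative_linear by blast+
  \<comment> \<open>The coordinate directions of \<open>a\<close> and \<open>b\<close> are eigenvectors of the Jacobian of the flux, found by
    differentiating the flux along the coordinate curves.\<close>
  have Df1: "Df (c a b) (1, a) = a *\<^sub>R (1, a)" if "b < a" for a b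
  proof -
    have "((\<lambda>a. flux (c a b)) has_derivative (\<lambda>h. Df (c a b) (h *\<^sub>R (1, a)))) (at a)"
      using D[OF c_nv[OF that]] by (intro has_derivative_compose[OF ca]) auto
    moreover have "((\<lambda>a. flux (c a b)) has_derivative (\<lambda>h. h *\<^sub>R (a *\<^sub>R (1, a)))) (at a)"
    proof (rule has_derivative_transform_within_open)
      show "((\<lambda>a. ((a\<^sup>2 - b\<^sup>2) / 2, (a ^ 3 - b ^ 3) / 3)) has_derivative (\<lambda>h. h *\<^sub>R (a *\<^sub>R (1, a)))) (at a)"
        by (auto intro!: derivative_eq_intros simp: power2_eq_square)
      show "open {b<..}" "a \<in> {b<..}" using that by auto
    qed (use flux_c in auto)
    ultimately have "(\<lambda>h. Df (c a b) (h *\<^sub>R (1, a))) = (\<lambda>h. h *\<^sub>R (a *\<^sub>R (1, a)))"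
      by (rule has_derivative_unique)
    from fun_cong[OF this, of 1] show ?thesis by simp
  qed
  have Df2: "Df (c a b) (-1, -b) = b *\<^sub>R (-1, -b)" if "b < a" for a b
  proof -
    have "((\<lambda>b. flux (c a b)) has_derivative (\<lambda>h. Df (c a b) (h *\<^sub>R (-1, -b)))) (at b)"
      using D[OF c_nv[OF that]] by (intro has_derivative_compose[OF cb]) auto
    moreover have "((\<lambda>b. flux (c a b)) has_derivative (\<lambda>h. h *\<^sub>R (b *\<^sub>R (-1, -b)))) (at b)"
    proof (rule has_derivative_transform_within_open)
      show "((\<lambda>b. ((a\<^sup>2 - b\<^sup>2) / 2, (a ^ 3 - b ^ 3) / 3)) has_derivative (\<lambda>h. h *\<^sub>R (b *\<^sub>R (-1, -b)))) (at b)"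
        by (auto intro!: derivative_eq_intros simp: power2_eq_square)
      show "open {..<a}" "b \<in> {..<a}" using that by auto
    qed (use flux_c in auto)
    ultimately have "(\<lambda>h. Df (c a b) (h *\<^sub>R (-1, -b))) = (\<lambda>h. h *\<^sub>R (b *\<^sub>R (-1, -b)))"
      by (rule has_derivative_unique)
    from fun_cong[OF this, of 1] show ?thesis by simp
  qed
  define Ha where "Ha = (\<lambda>a b. D\<eta> (c a b) (1, a))"
  define Hb where "Hb = (\<lambda>a b. D\<eta> (c a b) (-1, -b))"
  have cont_\<eta>: "continuous_on nonvacuum \<eta>" using ent by (simp add: entropy_pair_def)
  interpret riemann_invariant_pair H K Ha Hb
  proof
    have "continuous_on {(a, b). b < a} (\<lambda>z. \<eta> (c (fst z) (snd z)))"
      using c_nv by (intro continuous_on_compose2[OF cont_\<eta>]) (auto simp: c_def intro!: continuous_intros)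
    then show "continuous_on {(a, b). b < a} (\<lambda>(a, b). H a b)"
      by (simp add: H_def case_prod_beta')
  next
    fix a b :: real assume ab: "b < a"
    note nv = c_nv[OF ab]
    have lin_D: "linear (D\<eta> (c a b))" using lin nv by blast
    have D\<eta>: "(\<eta> has_derivative D\<eta> (c a b)) (at (c a b))"
      and Dq: "(q has_derivative D\<eta> (c a b) \<circ> Df (c a b)) (at (c a b))"
      using D[OF nv] by auto
    show "((\<lambda>a. H a b) has_real_derivative Ha a b) (at a)"
      using has_derivative_compose[OF ca[where a = a and b = b] D\<eta>]
      by (simp add: H_def Ha_def has_field_derivative_def linear_scale[OF lin_D] mult.commute[of _ "D\<eta> _ _"] del: scaleR_Pair)
    show "((\<lambda>b. H a b) has_real_derivative Hb a b) (at b)"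
      using has_derivative_compose[OF cb[where a = a and b = b] D\<eta>]
      by (simp add: H_def Hb_def has_field_derivative_def linear_scale[OF lin_D] mult.commute[of _ "D\<eta> _ _"] del: scaleR_Pair)
    show "((\<lambda>a. K a b) has_real_derivative a * Ha a b) (at a)"
      unfolding K_def has_field_derivative_def
      by (rule has_derivative_eq_rhs[OF has_derivative_compose[OF ca Dq]])
        (simp add: fun_eq_iff Ha_def linear_scale[OF lin_D] linear_scale[OF lin(2)[OF nv]] Df1[OF ab] mult_ac
          del: scaleR_Pair)
    show "((\<lambda>b. K a b) has_real_derivative b * Hb a b) (at b)"
      unfolding K_def has_field_derivative_def
      by (rule has_derivative_eq_rhs[OF has_derivative_compose[OF cb Dq]])
        (simp add: fun_eq_iff Hb_def linear_scale[OF lin_D] linear_scale[OF lin(2)[OF nv]] Df2[OF ab] mult_ac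
          del: scaleR_Pair)
  qed
  have of_state: "(\<rho>, m) = c (m / \<rho> + \<rho> / 2) (m / \<rho> - \<rho> / 2)" if "0 < \<rho>" for \<rho> m
    using that by (simp add: c_def power2_eq_square field_simps)
  have ray: "(\<rho>, \<rho> * v) = c (v + \<rho> / 2) (v - \<rho> / 2)" for \<rho> v
    by (simp add: c_def power2_eq_square field_simps)
  \<comment> \<open>The limits are written with the rectangle whose corner is the vacuum state of velocity \<open>0\<close>; by
    the lemma \<open>rectangle\<close> every larger rectangle with this corner gives the same values.\<close>
  define L where "L = H 0 (-1) + H 1 0 - H 1 (-1)"
  define N where "N = K 0 (-1) + K 1 0 - K 1 (-1)"
  have both: "(\<eta> \<longlongrightarrow> L) (at (0, 0) within {(\<rho>, m). 0 < \<rho> \<and> \<bar>m\<bar> \<le> M * \<rho>}) \<and>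
      (q \<longlongrightarrow> N) (at (0, 0) within {(\<rho>, m). 0 < \<rho> \<and> \<bar>m\<bar> \<le> M * \<rho>})" if M: "0 \<le> M" for M
  proof -
    define b where "b = - M - 1"
    define a where "a = M + 1"
    define J where "J = {b<..<a}"
    have ba: "b < 0" "0 < a" "b < a" using M by (auto simp: a_def b_def)
    define PH where "PH = (\<lambda>x. H x b)"
    define QH where "QH = (\<lambda>y. H a y - H a b)"
    define PK where "PK = (\<lambda>x. K x b)"
    define QK where "QK = (\<lambda>y. K a y - K a b)"
    have split: "H x y = PH x + QH y" "K x y = PK x + QK y" if "x \<in> J" "y \<in> J" "y < x" for x y
      using rectangle[of y x b a] that by (auto simp: PH_def QH_def PK_def QK_def J_def)
    have derivs: "(PH has_real_derivative Ha x b) (at x)" "(QH has_real_derivative Hb a x) (at x)"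
      "(PK has_real_derivative x * Ha x b) (at x)" "(QK has_real_derivative x * Hb a x) (at x)" if "x \<in> J" for x
      using that H1[of b x] H2[of x a] K1[of b x] K2[of x a]
      unfolding PH_def QH_def PK_def QK_def J_def by (auto intro!: derivative_eq_intros)
    have conts: "continuous_on J PH" "continuous_on J QH" "continuous_on J PK" "continuous_on J QK"
      using derivs by (auto intro!: continuous_at_imp_continuous_on DERIV_isCont)
    have at0: "PH 0 + QH 0 = L" "PK 0 + QK 0 = N"
      using rectangle[of "-1" 0 b 1] rectangle[of b 1 0 a] M ba
      by (auto simp: PH_def QH_def PK_def QK_def L_def N_def a_def b_def)
    have ray_lim: "((\<lambda>\<rho>. \<eta> (\<rho>, \<rho> * v)) \<longlongrightarrow> PH v + QH v) (at_right 0)" if v: "v \<in> J" for v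
    proof (rule Lim_transform_eventually)
      have "isCont PH v" "isCont QH v"
        using derivs[OF v] DERIV_isCont by blast+
      then show "((\<lambda>\<rho>. PH (v + \<rho> / 2) + QH (v - \<rho> / 2)) \<longlongrightarrow> PH v + QH v) (at_right 0)"
        by (auto intro!: tendsto_intros isCont_tendsto_compose[of v PH] isCont_tendsto_compose[of v QH] tendsto_eq_intros)
      have "0 < min (a - v) (v - b)" using v by (auto simp: J_def)
      then show "\<forall>\<^sub>F \<rho> in at_right 0. PH (v + \<rho> / 2) + QH (v - \<rho> / 2) = \<eta> (\<rho>, \<rho> * v)"
        unfolding eventually_at_right_field
      proof (intro exI[of _ "min (a - v) (v - b)"] conjI allI impI)
        fix \<rho> assume "0 < \<rho>" "\<rho> < min (a - v) (v - b)"
        then show "PH (v + \<rho> / 2) + QH (v - \<rho> / 2) = \<eta> (\<rho>, \<rho> * v)"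
          using split(1)[of "v + \<rho> / 2" "v - \<rho> / 2"] v by (simp add: J_def ray H_def)
      qed
    qed
    have le: "PH v + QH v \<le> PH w + QH w" if v: "v \<in> J" and w: "w \<in> J" for v w
    proof -
      have conv: "convex_on nonvacuum \<eta>" using ent by (simp add: entropy_pair_def)
      have *: "\<eta> (t, t * v) \<le> t * \<eta> (1, v) + (1 - t) * (PH w + QH w)" if t: "0 < t" "t < 1" for t
      proof (rule tendsto_le[of "at_right (0::real)"])
        show "((\<lambda>s. t * \<eta> (1, v) + (1 - t) * \<eta> (s, s * w)) \<longlongrightarrow> t * \<eta> (1, v) + (1 - t) * (PH w + QH w)) (at_right 0)"
          by (intro tendsto_intros ray_lim w)
        have "isCont \<eta> (t, t * v)"
          using cont_\<eta> t open_nonvacuum by (simp add: continuous_on_eq_continuous_at nonvacuum_def)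
        then show "((\<lambda>s. \<eta> (t *\<^sub>R (1, v) + (1 - t) *\<^sub>R (s, s * w))) \<longlongrightarrow> \<eta> (t, t * v)) (at_right 0)"
          by (rule isCont_tendsto_compose) (auto intro!: tendsto_eq_intros)
        show "\<forall>\<^sub>F s in at_right 0. \<eta> (t *\<^sub>R (1, v) + (1 - t) *\<^sub>R (s, s * w)) \<le> t * \<eta> (1, v) + (1 - t) * \<eta> (s, s * w)"
          unfolding eventually_at_right_field
        proof (intro exI[of _ 1] conjI allI impI)
          fix s :: real assume "0 < s" "s < 1"
          then show "\<eta> (t *\<^sub>R (1, v) + (1 - t) *\<^sub>R (s, s * w)) \<le> t * \<eta> (1, v) + (1 - t) * \<eta> (s, s * w)"
            using convex_onD[OF conv, of "1 - t" "(1, v)" "(s, s * w)"] t by (simp add: nonvacuum_def)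
        qed simp
      qed simp
      show ?thesis
      proof (rule tendsto_le[of "at_right (0::real)"])
        show "((\<lambda>t. t * \<eta> (1, v) + (1 - t) * (PH w + QH w)) \<longlongrightarrow> PH w + QH w) (at_right 0)"
          by (auto intro!: tendsto_eq_intros)
        show "((\<lambda>t. \<eta> (t, t * v)) \<longlongrightarrow> PH v + QH v) (at_right 0)" by (rule ray_lim[OF v])
        show "\<forall>\<^sub>F t in at_right 0. \<eta> (t, t * v) \<le> t * \<eta> (1, v) + (1 - t) * (PH w + QH w)"
          unfolding eventually_at_right_field using * by (intro exI[of _ 1]) auto
      qed simp
    qed
    have J0: "0 \<in> J" using ba by (simp add: J_def)
    have constH: "PH v + QH v = L" if "v \<in> J" for v
      using le[OF that J0] le[OF J0 that] at0 by simp
    have "((\<lambda>v. PK v + QK v) has_field_derivative 0) (at v within J)" if v: "v \<in> J" for v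
    proof -
      have "((\<lambda>v. PH v + QH v) has_real_derivative (Ha v b + Hb a v)) (at v)"
        using derivs[OF v] by (intro derivative_intros)
      moreover have "((\<lambda>v. PH v + QH v) has_real_derivative 0) (at v)"
      proof (rule has_field_derivative_transform_within_open)
        show "((\<lambda>_. L) has_real_derivative 0) (at v)" by simp
        show "open J" "v \<in> J" using v by (auto simp: J_def)
      qed (use constH in auto)
      ultimately have "Ha v b + Hb a v = 0" by (rule DERIV_unique)
      then have "v * Ha v b + v * Hb a v = 0" by (simp add: distrib_left[symmetric])
      then have "((\<lambda>v. PK v + QK v) has_real_derivative 0) (at v)"
        using DERIV_add[OF derivs(3,4)[OF v]] by simp
      then show ?thesis by (rule DERIV_subset) simp
    qed
    then obtain k where k: "\<forall>v\<in>J. PK v + QK v = k"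
      using has_field_derivative_zero_constant[of J "\<lambda>v. PK v + QK v"] by (auto simp: J_def)
    then have constK: "PK v + QK v = N" if "v \<in> J" for v
      using that J0 at0 by metis
    show ?thesis
    proof
      show "(\<eta> \<longlongrightarrow> L) (at (0, 0) within {(\<rho>, m). 0 < \<rho> \<and> \<bar>m\<bar> \<le> M * \<rho>})"
      proof (rule tendsto_vacuum[OF M])
        show "\<eta> (\<rho>, m) = PH (m / \<rho> + \<rho> / 2) + QH (m / \<rho> - \<rho> / 2)" if "0 < \<rho>" "\<rho> < 1" "\<bar>m\<bar> \<le> M * \<rho>" for \<rho> m
          using velocity_bounds[OF that] that split(1)[of "m / \<rho> + \<rho> / 2" "m / \<rho> - \<rho> / 2"]
          by (subst of_state) (auto simp: H_def J_def a_def b_def)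
      qed (use conts constH in \<open>auto simp: J_def a_def b_def\<close>)
      show "(q \<longlongrightarrow> N) (at (0, 0) within {(\<rho>, m). 0 < \<rho> \<and> \<bar>m\<bar> \<le> M * \<rho>})"
      proof (rule tendsto_vacuum[OF M])
        show "q (\<rho>, m) = PK (m / \<rho> + \<rho> / 2) + QK (m / \<rho> - \<rho> / 2)" if "0 < \<rho>" "\<rho> < 1" "\<bar>m\<bar> \<le> M * \<rho>" for \<rho> m
          using velocity_bounds[OF that] that split(2)[of "m / \<rho> + \<rho> / 2" "m / \<rho> - \<rho> / 2"]
          by (subst of_state) (auto simp: K_def J_def a_def b_def)
      qed (use conts constK in \<open>auto simp: J_def a_def b_def\<close>)
    qed
  qed
  show ?thesis
  proof (intro exI allI)
    fix M :: real
    have sub: "{(\<rho>, m). 0 < \<rho> \<and> \<bar>m\<bar> \<le> M * \<rho>} \<subseteq> {(\<rho>, m). 0 < \<rho> \<and> \<bar>m\<bar> \<le> max M 0 * \<rho>}"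
      by (auto intro: order.trans mult_right_mono)
    show "(\<eta> \<longlongrightarrow> L) (at (0, 0) within {(\<rho>, m). 0 < \<rho> \<and> \<bar>m\<bar> \<le> M * \<rho>}) \<and>
      (q \<longlongrightarrow> N) (at (0, 0) within {(\<rho>, m). 0 < \<rho> \<and> \<bar>m\<bar> \<le> M * \<rho>})"
      using both[of "max M 0"] tendsto_within_subset[OF _ sub] by auto
  qed
qed

text \<open>
  This reduces the entropy pairs that are tested at two nonvacuum states to pairs with limits at
  vacuum, for which the entropy inequality of \<open>u\<close> holds whether or not \<open>u\<close> takes the vacuum state.
\<close>

lemma entropy_pair_vacuum_extension:
  assumes ent: "entropy_pair \<eta> q"
  obtains \<eta>' q' where "entropy_pair \<eta>' q'" "vacuum_limit \<eta>'" "vacuum_limit q'"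
    "\<And>v. v \<in> nonvacuum \<Longrightarrow> \<eta>' v = \<eta> v \<and> q' v = q v"
proof -
  obtain L N where LN: "\<And>M. (\<eta> \<longlongrightarrow> L) (at (0, 0) within {(\<rho>, m). 0 < \<rho> \<and> \<bar>m\<bar> \<le> M * \<rho>})"
      "\<And>M. (q \<longlongrightarrow> N) (at (0, 0) within {(\<rho>, m). 0 < \<rho> \<and> \<bar>m\<bar> \<le> M * \<rho>})"
    using entropy_limits[OF ent] by blast
  define \<eta>' where "\<eta>' = \<eta>((0, 0) := L)"
  define q' where "q' = q((0, 0) := N)"
  have eq: "\<eta>' v = \<eta> v" "q' v = q v" if "v \<in> nonvacuum" for v
    using that by (auto simp: \<eta>'_def q'_def nonvacuum_def)
  have transform: "(f' has_derivative D) (at v)"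
    if "(f has_derivative D) (at v)" "v \<in> nonvacuum" "\<And>w. w \<in> nonvacuum \<Longrightarrow> f' w = f w"
    for f f' :: "real \<times> real \<Rightarrow> real" and D v
    using that by (intro has_derivative_transform_within_open[OF that(1) open_nonvacuum that(2)]) auto
  have "entropy_pair \<eta>' q'"
    unfolding entropy_pair_def
  proof (intro conjI ballI)
    show "convex_on nonvacuum \<eta>'"
      using ent eq unfolding entropy_pair_def convex_on_def convex_def by simp
    show "continuous_on nonvacuum \<eta>'" "continuous_on nonvacuum q'"
      using ent eq by (auto simp: entropy_pair_def cong: continuous_on_cong)
    show "\<exists>D\<eta> Df. (\<eta>' has_derivative D\<eta>) (at v) \<and> (flux has_derivative Df) (at v) \<and>
        (q' has_derivative D\<eta> \<circ> Df) (at v)" if v: "v \<in> nonvacuum" for v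
    proof -
      obtain D\<eta> Df where "(\<eta> has_derivative D\<eta>) (at v)" "(flux has_derivative Df) (at v)"
        "(q has_derivative (D\<eta> \<circ> Df)) (at v)"
        using ent v unfolding entropy_pair_def by blast
      then show ?thesis
        using transform[OF _ v, of _ _ \<eta>'] transform[OF _ v, of _ _ q'] eq by blast
    qed
  qed
  moreover have "vacuum_limit \<eta>'" "vacuum_limit q'"
    unfolding vacuum_limit_def
  proof (safe)
    fix M :: real
    have ev: "\<forall>\<^sub>F z in at (0, 0) within {(\<rho>, m). 0 < \<rho> \<and> \<bar>m\<bar> \<le> M * \<rho>}. \<eta> z = \<eta>' z \<and> q z = q' z"
      using eq by (auto simp: eventually_at_filter nonvacuum_def intro!: always_eventually)
    show "(\<eta>' \<longlongrightarrow> \<eta>' (0, 0)) (at (0, 0) within {(\<rho>, m). 0 < \<rho> \<and> \<bar>m\<bar> \<le> M * \<rho>})"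
      using Lim_transform_eventually[OF LN(1) eventually_mono[OF ev]] by (simp add: \<eta>'_def)
    show "(q' \<longlongrightarrow> q' (0, 0)) (at (0, 0) within {(\<rho>, m). 0 < \<rho> \<and> \<bar>m\<bar> \<le> M * \<rho>})"
      using Lim_transform_eventually[OF LN(2) eventually_mono[OF ev]] by (simp add: q'_def)
  qed
  ultimately show thesis using that eq by blast
qed

section \<open>Smooth test functions\<close>

lemma frechet_eq: "(f has_derivative D) (at z) \<Longrightarrow> frechet_derivative f (at z) = D"
  using frechet_derivative_at by metis

lemma Ck_SucD: "Ck (Suc n) \<phi> \<Longrightarrow> Ck n \<phi>"
proof (induction n arbitrary: \<phi>)
  case 0
  then show ?case
    by (auto intro: continuous_at_imp_continuous_on differentiable_imp_continuous_within)
next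
  case (Suc n)
  then show ?case by auto
qed

lemma Ck_add: "Ck n \<phi> \<Longrightarrow> Ck n \<psi> \<Longrightarrow> Ck n (\<lambda>z. \<phi> z + \<psi> z)"
proof (induction n arbitrary: \<phi> \<psi>)
  case (Suc n)
  have "frechet_derivative (\<lambda>z. \<phi> z + \<psi> z) (at z) =
      (\<lambda>b. frechet_derivative \<phi> (at z) b + frechet_derivative \<psi> (at z) b)" for z
    using Suc.prems by (intro frechet_eq has_derivative_add) (auto simp: frechet_derivative_works)
  then show ?case
    using Suc by simp
qed (auto intro: continuous_intros)

lemma Ck_mult: "Ck n \<phi> \<Longrightarrow> Ck n \<psi> \<Longrightarrow> Ck n (\<lambda>z. \<phi> z * \<psi> z)"
proof (induction n arbitrary: \<phi> \<psi>)
  case (Suc n)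
  have "frechet_derivative (\<lambda>z. \<phi> z * \<psi> z) (at z) =
      (\<lambda>b. \<phi> z * frechet_derivative \<psi> (at z) b + frechet_derivative \<phi> (at z) b * \<psi> z)" for z
    using Suc.prems by (intro frechet_eq has_derivative_mult) (auto simp: frechet_derivative_works)
  then show ?case
    using Suc.prems Suc.IH Ck_SucD[OF Suc.prems(1)] Ck_SucD[OF Suc.prems(2)]
    by (auto intro!: Ck_add)
qed (auto intro: continuous_intros)

lemma Ck_const: "Ck n (\<lambda>z. c)"
proof (induction n arbitrary: c)
  case (Suc n)
  have "frechet_derivative (\<lambda>z::'a. c) (at z) = (\<lambda>b. 0)" for z
    by (intro frechet_eq has_derivative_const)
  then show ?case using Suc[of 0] by simp
qed simp

text \<open>
  The smooth function \<open>exp (- 1 / x)\<close>, continued by \<open>0\<close>, together with polynomial factors in \<open>1 / x\<close>,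
  which make the family closed under differentiation.
\<close>

definition flat :: "real poly \<Rightarrow> real \<Rightarrow> real" where
  "flat p x = (if 0 < x then poly p (1 / x) * exp (- 1 / x) else 0)"

definition flat_deriv :: "real poly \<Rightarrow> real poly" where
  "flat_deriv p = [:0, 0, 1:] * (p - pderiv p)"

lemma poly_exp_tendsto_0: "((\<lambda>y. poly p y * exp (- y)) \<longlongrightarrow> 0) (at_top :: real filter)"
proof -
  have "((\<lambda>y. \<Sum>i\<le>degree p. coeff p i * (y ^ i / exp y)) \<longlongrightarrow> (\<Sum>i\<le>degree p. coeff p i * 0)) at_top"
    by (intro tendsto_intros tendsto_power_div_exp_0)
  then show ?thesis
    by (simp add: poly_altdef exp_minus sum_distrib_left divide_inverse mult_ac)
qed

lemma flat_has_derivative: "(flat p has_real_derivative flat (flat_deriv p) x) (at x)"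
proof -
  consider "x < 0" | "x = 0" | "0 < x" by linarith
  then show ?thesis
  proof cases
    case 1
    have "(flat p has_real_derivative 0) (at x)"
    proof (rule has_field_derivative_transform_within_open)
      show "((\<lambda>_. 0) has_real_derivative 0) (at x)" by simp
      show "open {..<0::real}" "x \<in> {..<0}" using 1 by auto
    qed (auto simp: flat_def)
    then show ?thesis using 1 by (simp add: flat_def)
  next
    case 3
    have "((\<lambda>x. poly p (1 / x) * exp (- 1 / x)) has_real_derivative flat (flat_deriv p) x) (at x)"
      using 3 by (auto intro!: derivative_eq_intros DERIV_chain'[of "\<lambda>x. 1 / x" _ _ _ "poly p"] poly_DERIV
          simp: flat_def flat_deriv_def field_simps power2_eq_square)
    then show ?thesis
    proof (rule has_field_derivative_transform_within_open)
      show "open {0::real<..}" "x \<in> {0<..}" using 3 by auto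
    qed (auto simp: flat_def)
  next
    case 2
    have "((\<lambda>y. flat p y / y) \<longlongrightarrow> 0) (at_left 0)"
      by (rule Lim_transform_eventually[OF tendsto_const])
        (auto simp: eventually_at_left_field flat_def intro: exI[of _ "-1"])
    moreover have "((\<lambda>y. flat p y / y) \<longlongrightarrow> 0) (at_right 0)"
    proof (rule Lim_transform_eventually)
      have "filterlim (\<lambda>y::real. inverse y) at_top (at_right 0)"
        by (rule filterlim_inverse_at_top_right)
      from filterlim_compose[OF poly_exp_tendsto_0[of "[:0, 1:] * p"] this]
      show "((\<lambda>y. poly ([:0, 1:] * p) (inverse y) * exp (- inverse y)) \<longlongrightarrow> 0) (at_right 0)" .
      show "\<forall>\<^sub>F y in at_right 0. poly ([:0, 1:] * p) (inverse y) * exp (- inverse y) = flat p y / y"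
        unfolding eventually_at_right_field
        by (intro exI[of _ 1]) (auto simp: flat_def divide_inverse)
    qed
    ultimately have "((\<lambda>y. flat p y / y) \<longlongrightarrow> 0) (at 0)"
      by (simp add: filterlim_split_at_real)
    then show ?thesis
      using 2 by (simp add: has_field_derivative_iff flat_def)
  qed
qed

lemma flat_nonneg: "0 \<le> flat 1 x" and flat_pos_iff: "0 < flat 1 x \<longleftrightarrow> 0 < x"
  by (auto simp: flat_def)

lemma flat_eq_0: "x \<le> 0 \<Longrightarrow> flat p x = 0"
  by (simp add: flat_def)

text \<open>
  A derivative of such a function is a constant times another function of the family.
\<close>

lemma Ck_flat: "Ck n (\<lambda>z::real \<times> real. flat p (a * fst z + b * snd z + c))"
proof (induction n arbitrary: p)
  case 0
  have "continuous_on UNIV (flat p)"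
    using flat_has_derivative by (metis DERIV_isCont continuous_at_imp_continuous_on)
  then show ?case
    by (auto intro!: continuous_on_compose2[of UNIV "flat p"] continuous_intros)
next
  case (Suc n)
  have D: "((\<lambda>z. flat p (a * fst z + b * snd z + c)) has_derivative
     (\<lambda>h. (a * fst h + b * snd h) * flat (flat_deriv p) (a * fst z + b * snd z + c))) (at z)" for z
  proof -
    have "((\<lambda>z. a * fst z + b * snd z + c) has_derivative (\<lambda>h. a * fst h + b * snd h)) (at z)"
      by (auto intro!: derivative_eq_intros)
    from has_derivative_compose[OF this flat_has_derivative[THEN has_field_derivative_imp_has_derivative]]
    show ?thesis by (simp add: mult.commute)
  qed
  have "Ck n (\<lambda>z. (a * fst h + b * snd h) * flat (flat_deriv p) (a * fst z + b * snd z + c))" for h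
    by (intro Ck_mult Ck_const Suc)
  moreover have "(\<lambda>z. flat p (a * fst z + b * snd z + c)) differentiable (at z)" for z
    using D[of z] unfolding differentiable_def by blast
  ultimately show ?case
    unfolding Ck.simps frechet_eq[OF D] by blast
qed

definition bump :: "real \<Rightarrow> real" where
  "bump x = flat 1 (1 + x) * flat 1 (1 - x)"

definition bump' :: "real \<Rightarrow> real" where
  "bump' x = flat (flat_deriv 1) (1 + x) * flat 1 (1 - x) - flat 1 (1 + x) * flat (flat_deriv 1) (1 - x)"

lemma bump_DERIV: "(bump has_real_derivative bump' x) (at x)"
proof -
  have "((\<lambda>x. flat 1 (1 + x)) has_real_derivative flat (flat_deriv 1) (1 + x) * 1) (at x)"
       "((\<lambda>x. flat 1 (1 - x)) has_real_derivative flat (flat_deriv 1) (1 - x) * (- 1)) (at x)"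
    by (rule DERIV_chain2[OF flat_has_derivative]; auto intro!: derivative_eq_intros)+
  from DERIV_mult[OF this] show ?thesis
    by (simp add: bump_def[abs_def] bump'_def algebra_simps)
qed

lemma continuous_flat: "continuous_on A (flat p)"
  using flat_has_derivative by (meson DERIV_isCont continuous_at_imp_continuous_on)

lemma continuous_bump: "continuous_on A bump" "continuous_on A bump'"
  unfolding bump_def[abs_def] bump'_def[abs_def]
  by (intro continuous_intros continuous_on_compose2[OF continuous_flat[of UNIV]]; auto)+

lemma bump_nonneg: "0 \<le> bump x"
  by (simp add: bump_def flat_nonneg)

lemma bump_pos: "\<bar>x\<bar> < 1 \<Longrightarrow> 0 < bump x"
  by (auto simp: bump_def flat_pos_iff intro!: mult_pos_pos)

lemma bump_eq_0: "1 \<le> \<bar>x\<bar> \<Longrightarrow> bump x = 0" "1 \<le> \<bar>x\<bar> \<Longrightarrow> bump' x = 0"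
  by (cases "x \<le> -1"; simp add: bump_def bump'_def flat_eq_0)+

text \<open>
  The bump of size \<open>\<epsilon>\<close> at \<open>(t0, x0)\<close> is sheared along lines of slope \<open>\<sigma>\<close>. In coordinates that move with
  the curve it becomes, in the limit, the product \<open>bump s * bump y\<close>, against which the step
  function can be integrated by hand.
\<close>

definition moving_bump :: "real \<Rightarrow> real \<Rightarrow> real \<Rightarrow> real \<Rightarrow> real \<times> real \<Rightarrow> real" where
  "moving_bump \<epsilon> t0 x0 \<sigma> = (\<lambda>(t, x). bump ((t - t0) / \<epsilon>) * bump ((x - x0 - \<sigma> * (t - t0)) / \<epsilon>))"

lemma moving_bump_derivative:
  assumes "\<epsilon> \<noteq> 0"
  shows "frechet_derivative (moving_bump \<epsilon> t0 x0 \<sigma>) (at (t, x)) (1, 0) =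
      (bump' ((t - t0) / \<epsilon>) * bump ((x - x0 - \<sigma> * (t - t0)) / \<epsilon>)
        - \<sigma> * bump ((t - t0) / \<epsilon>) * bump' ((x - x0 - \<sigma> * (t - t0)) / \<epsilon>)) / \<epsilon>"
    "frechet_derivative (moving_bump \<epsilon> t0 x0 \<sigma>) (at (t, x)) (0, 1) =
      bump ((t - t0) / \<epsilon>) * bump' ((x - x0 - \<sigma> * (t - t0)) / \<epsilon>) / \<epsilon>"
proof -
  define \<tau> where "\<tau> = (\<lambda>z::real \<times> real. (fst z - t0) / \<epsilon>)"
  define \<xi> where "\<xi> = (\<lambda>z::real \<times> real. (snd z - x0 - \<sigma> * (fst z - t0)) / \<epsilon>)"
  have bD: "((\<lambda>z. bump (f z)) has_derivative (\<lambda>h. bump' (f z) * f' h)) (at z)"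
    if "(f has_derivative f') (at z)" for f :: "real \<times> real \<Rightarrow> real" and f' z
    using has_derivative_compose[OF that bump_DERIV[THEN has_field_derivative_imp_has_derivative]] .
  have 1: "(\<tau> has_derivative (\<lambda>h. fst h / \<epsilon>)) (at z)" for z
    unfolding \<tau>_def using assms by (auto intro!: derivative_eq_intros)
  have 2: "(\<xi> has_derivative (\<lambda>h. (snd h - \<sigma> * fst h) / \<epsilon>)) (at z)" for z
    unfolding \<xi>_def using assms by (auto intro!: derivative_eq_intros)
  have "(moving_bump \<epsilon> t0 x0 \<sigma> has_derivative (\<lambda>h. bump (\<tau> z) * (bump' (\<xi> z) * ((snd h - \<sigma> * fst h) / \<epsilon>))
     + bump' (\<tau> z) * (fst h / \<epsilon>) * bump (\<xi> z))) (at z)" for z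
    using has_derivative_mult[OF bD[OF 1] bD[OF 2], of z]
    by (simp add: moving_bump_def \<tau>_def \<xi>_def case_prod_beta')
  note * = frechet_eq[OF this]
  show "frechet_derivative (moving_bump \<epsilon> t0 x0 \<sigma>) (at (t, x)) (1, 0) =
      (bump' ((t - t0) / \<epsilon>) * bump ((x - x0 - \<sigma> * (t - t0)) / \<epsilon>)
        - \<sigma> * bump ((t - t0) / \<epsilon>) * bump' ((x - x0 - \<sigma> * (t - t0)) / \<epsilon>)) / \<epsilon>"
    "frechet_derivative (moving_bump \<epsilon> t0 x0 \<sigma>) (at (t, x)) (0, 1) =
      bump ((t - t0) / \<epsilon>) * bump' ((x - x0 - \<sigma> * (t - t0)) / \<epsilon>) / \<epsilon>"
    by (simp_all add: * \<tau>_def \<xi>_def diff_divide_distrib)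
qed

lemma test_function_moving_bump:
  assumes \<epsilon>: "0 < \<epsilon>" "\<epsilon> < t0"
  shows "test_function (moving_bump \<epsilon> t0 x0 \<sigma>)" "\<And>z. 0 \<le> moving_bump \<epsilon> t0 x0 \<sigma> z"
proof -
  \<comment> \<open>The form of the four factors to which \<open>Ck_flat\<close> applies.\<close>
  have eq: "moving_bump \<epsilon> t0 x0 \<sigma> = (\<lambda>z.
      (flat 1 ((1 / \<epsilon>) * fst z + 0 * snd z + (1 - t0 / \<epsilon>)) * flat 1 ((- 1 / \<epsilon>) * fst z + 0 * snd z + (1 + t0 / \<epsilon>)))
    * (flat 1 ((- \<sigma> / \<epsilon>) * fst z + (1 / \<epsilon>) * snd z + (1 + (- x0 + \<sigma> * t0) / \<epsilon>))
      * flat 1 ((\<sigma> / \<epsilon>) * fst z + (- 1 / \<epsilon>) * snd z + (1 - (- x0 + \<sigma> * t0) / \<epsilon>))))"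
    by (auto simp: moving_bump_def bump_def fun_eq_iff diff_divide_distrib add_divide_distrib algebra_simps)
  have Ck: "Ck n (moving_bump \<epsilon> t0 x0 \<sigma>)" for n
    unfolding eq by (intro Ck_mult Ck_flat)
  define S where "S = {z. \<bar>fst z - t0\<bar> \<le> \<epsilon>} \<inter> {z. \<bar>snd z - x0 - \<sigma> * (fst z - t0)\<bar> \<le> \<epsilon>}"
  have "closed S"
    unfolding S_def by (intro closed_Int closed_Collect_le continuous_intros)
  have "bounded S"
  proof (rule bounded_subset[OF bounded_cbox])
    show "S \<subseteq> cbox (t0 - \<epsilon>, x0 - \<epsilon> - \<bar>\<sigma>\<bar> * \<epsilon>) (t0 + \<epsilon>, x0 + \<epsilon> + \<bar>\<sigma>\<bar> * \<epsilon>)"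
    proof
      fix z assume z: "z \<in> S"
      have "\<bar>\<sigma> * (fst z - t0)\<bar> \<le> \<bar>\<sigma>\<bar> * \<epsilon>"
        using z by (auto simp: S_def abs_mult intro: mult_left_mono)
      then show "z \<in> cbox (t0 - \<epsilon>, x0 - \<epsilon> - \<bar>\<sigma>\<bar> * \<epsilon>) (t0 + \<epsilon>, x0 + \<epsilon> + \<bar>\<sigma>\<bar> * \<epsilon>)"
        using z by (cases z) (auto simp: S_def abs_le_iff cbox_Pair_eq)
    qed
  qed
  have "z \<in> S" if "moving_bump \<epsilon> t0 x0 \<sigma> z \<noteq> 0" for z
  proof (rule ccontr)
    assume "z \<notin> S"
    then have "1 \<le> \<bar>(fst z - t0) / \<epsilon>\<bar> \<or> 1 \<le> \<bar>(snd z - x0 - \<sigma> * (fst z - t0)) / \<epsilon>\<bar>"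
      using \<epsilon> by (auto simp: S_def abs_divide le_divide_eq)
    then show False using that bump_eq_0 by (auto simp: moving_bump_def case_prod_beta')
  qed
  then have cl: "closure {z. moving_bump \<epsilon> t0 x0 \<sigma> z \<noteq> 0} \<subseteq> S"
    using \<open>closed S\<close> by (intro closure_minimal) auto
  then have "compact (closure {z. moving_bump \<epsilon> t0 x0 \<sigma> z \<noteq> 0})"
    using \<open>bounded S\<close> bounded_subset by (auto simp: compact_eq_bounded_closed)
  moreover have "S \<subseteq> space_time"
    using \<epsilon> by (force simp: S_def space_time_def)
  ultimately show "test_function (moving_bump \<epsilon> t0 x0 \<sigma>)"
    using Ck cl by (auto simp: test_function_def)
  show "0 \<le> moving_bump \<epsilon> t0 x0 \<sigma> z" for z
    by (simp add: moving_bump_def bump_nonneg case_prod_beta')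
qed

section \<open>Translations, Borel versions and the change of variables\<close>

lemma nn_integral_shift:
  fixes f :: "real \<Rightarrow> ennreal"
  assumes "f \<in> borel_measurable borel"
  shows "(\<integral>\<^sup>+x. f (x + c) \<partial>lborel) = (\<integral>\<^sup>+x. f x \<partial>lborel)"
  using nn_integral_real_affine[OF assms, of 1 c] by (simp add: add.commute)

text \<open>
  \<open>P\<close> is the almost everywhere limit of continuous functions, which the projection \<open>\<pi>\<close> to a ball keeps
  bounded; so it is close in \<open>L\<^sup>1\<close> to a continuous function \<open>G n\<close>, which is uniformly continuous on an
  interval that contains the support of \<open>P\<close> and of its translates by at most \<open>1\<close>.
\<close>

lemma translation_L1_continuous:
  fixes P :: "real \<Rightarrow> 'a::euclidean_space"
  assumes P[measurable]: "P \<in> borel_measurable borel" and B: "\<And>t. norm (P t) \<le> B"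
    and supp: "\<And>t. t \<notin> {0..T} \<Longrightarrow> P t = 0" and \<epsilon>: "0 < \<epsilon>"
  shows "\<exists>\<delta>>0. \<forall>e. \<bar>e\<bar> < \<delta> \<longrightarrow> (\<integral>\<^sup>+t. ennreal (norm (P (t + e) - P t)) \<partial>lborel) \<le> ennreal \<epsilon>"
proof (cases "0 \<le> T")
  case False
  then have "P t = 0" for t using supp by auto
  then show ?thesis by (auto intro: exI[of _ 1])
next
  case T: True
  have B0: "0 \<le> B" using B[of 0] norm_ge_zero order_trans by blast
  have "P measurable_on UNIV"
    by (rule lebesgue_measurable_imp_measurable_on) (simp_all add: measurable_completion)
  then obtain N g where N: "negligible N" and g: "\<And>n. continuous_on UNIV (g n)"
    "\<And>x. x \<notin> N \<Longrightarrow> (\<lambda>n. g n x) \<longlonglongrightarrow> P x"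
    unfolding measurable_on_def by auto
  define \<pi> where "\<pi> = closest_point (cball (0::'a) B)"
  have ball: "convex (cball (0::'a) B)" "closed (cball (0::'a) B)" "cball (0::'a) B \<noteq> {}"
    using B0 by auto
  have \<pi>: "continuous_on UNIV \<pi>" "\<And>x. norm (\<pi> x) \<le> B" "\<And>x. norm x \<le> B \<Longrightarrow> \<pi> x = x"
    using continuous_on_closest_point[OF ball] closest_point_in_set[OF ball(2,3)] closest_point_self[of _ "cball 0 B"]
    by (auto simp: \<pi>_def)
  define G where "G = (\<lambda>n x. \<pi> (g n x))"
  have Gc: "continuous_on UNIV (G n)" for n
    unfolding G_def by (rule continuous_on_compose2[OF \<pi>(1) g(1)]) simp
  have Gm[measurable]: "G n \<in> borel_measurable borel" for n
    using Gc by (rule borel_measurable_continuous_onI)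
  define w where "w = (\<lambda>n t. indicator {-2..T + 2} t * ennreal (norm (P t - G n t)))"
  have [measurable]: "w n \<in> borel_measurable borel" for n
    unfolding w_def by measurable
  have "(\<lambda>n. \<integral>\<^sup>+t. w n t \<partial>lborel) \<longlonglongrightarrow> (\<integral>\<^sup>+t. 0 \<partial>(lborel :: real measure))"
  proof (rule nn_integral_dominated_convergence[where w = "\<lambda>t. indicator {-2..T + 2} t * ennreal (2 * B)"])
    show "AE t in lborel. w n t \<le> indicator {-2..T + 2} t * ennreal (2 * B)" for n
    proof (intro AE_I2)
      fix t
      have "norm (P t - G n t) \<le> 2 * B"
        using norm_triangle_ineq4[of "P t" "G n t"] B[of t] \<pi>(2)[of "g n t"] by (simp add: G_def)
      then show "w n t \<le> indicator {-2..T + 2} t * ennreal (2 * B)"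
        unfolding w_def by (intro mult_left_mono ennreal_leI) auto
    qed
    have "(\<integral>\<^sup>+t. indicator {-2..T + 2} t * ennreal (2 * B) \<partial>lborel) = emeasure lborel {-2..T + 2} * ennreal (2 * B)"
      by (simp add: nn_integral_multc)
    also have "\<dots> < \<infinity>"
      using T by (simp add: ennreal_mult_less_top)
    finally show "(\<integral>\<^sup>+t. indicator {-2..T + 2} t * ennreal (2 * B) \<partial>lborel) < \<infinity>" .
    have "AE t in lborel. t \<notin> N"
      using N AE_completion_iff[of "\<lambda>t. t \<notin> N" lborel] by (simp add: negligible_iff_null_sets AE_not_in)
    then show "AE t in lborel. (\<lambda>n. w n t) \<longlonglongrightarrow> 0"
    proof eventually_elim
      case (elim t)
      have "isCont \<pi> (P t)" using \<pi>(1) by (simp add: continuous_on_eq_continuous_at)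
      then have "(\<lambda>n. G n t) \<longlonglongrightarrow> \<pi> (P t)"
        unfolding G_def by (rule isCont_tendsto_compose) (use g(2) elim in auto)
      then have "(\<lambda>n. G n t) \<longlonglongrightarrow> P t"
        using \<pi>(3)[OF B] by simp
      then have "(\<lambda>n. norm (P t - G n t)) \<longlonglongrightarrow> norm (P t - P t)"
        by (intro tendsto_intros)
      then have "(\<lambda>n. ennreal (norm (P t - G n t))) \<longlonglongrightarrow> ennreal 0"
        by (intro tendsto_ennrealI) simp
      then have "(\<lambda>n. indicator {-2..T + 2} t * ennreal (norm (P t - G n t))) \<longlonglongrightarrow> indicator {-2..T + 2} t * ennreal 0"
        by (intro ennreal_tendsto_cmult) (auto simp: indicator_def)
      then show ?case by (simp add: w_def)
    qed
  qed auto
  then have "\<forall>\<^sub>F n in sequentially. (\<integral>\<^sup>+t. w n t \<partial>lborel) < ennreal (\<epsilon> / 3)"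
    using \<epsilon> by (intro order_tendstoD) auto
  then obtain n where n: "(\<integral>\<^sup>+t. w n t \<partial>lborel) < ennreal (\<epsilon> / 3)"
    by (auto simp: eventually_sequentially)
  \<comment> \<open>The error is split into three parts, and \<open>T + 2\<close> is the length of the interval
    \<open>{-1..T + 1}\<close> outside which \<open>P\<close> and its translates vanish.\<close>
  define c where "c = \<epsilon> / (3 * (T + 2))"
  have c: "0 < c" using \<epsilon> T by (simp add: c_def)
  have "uniformly_continuous_on {-2..T + 2} (G n)"
    using Gc by (intro compact_uniformly_continuous) (auto intro: continuous_on_subset)
  then obtain d where d: "0 < d" "\<And>x y. x \<in> {-2..T + 2} \<Longrightarrow> y \<in> {-2..T + 2} \<Longrightarrow> dist x y < d \<Longrightarrow> dist (G n x) (G n y) < c"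
    using c unfolding uniformly_continuous_on_def by metis
  show ?thesis
  proof (intro exI[of _ "min d 1"] conjI allI impI)
    show "0 < min d 1" using d by simp
    fix e :: real assume e: "\<bar>e\<bar> < min d 1"
    have pw: "ennreal (norm (P (t + e) - P t)) \<le> w n (t + e) + indicator {-1..T + 1} t * ennreal c + w n t" for t
    proof (cases "t \<in> {-1..T + 1}")
      case True
      then have t: "t \<in> {-2..T + 2}" "t + e \<in> {-2..T + 2}" using e by (auto simp: abs_less_iff)
      have "norm (G n (t + e) - G n t) \<le> c"
        using d(2)[OF t(2,1)] e by (simp add: dist_norm)
      moreover have "norm (P (t + e) - P t) \<le> norm (P (t + e) - G n (t + e)) + norm (G n (t + e) - G n t) + norm (P t - G n t)"
        by norm
      ultimately have "norm (P (t + e) - P t) \<le> norm (P (t + e) - G n (t + e)) + c + norm (P t - G n t)"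
        by linarith
      then have "ennreal (norm (P (t + e) - P t)) \<le> ennreal (norm (P (t + e) - G n (t + e)) + c + norm (P t - G n t))"
        by (rule ennreal_leI)
      also have "\<dots> = w n (t + e) + indicator {-1..T + 1} t * ennreal c + w n t"
        using t True c by (simp add: w_def ennreal_plus)
      finally show ?thesis .
    next
      case False
      then have "P t = 0" "P (t + e) = 0" using e by (auto intro!: supp simp: abs_less_iff)
      then show ?thesis by simp
    qed
    have "(\<integral>\<^sup>+t. ennreal (norm (P (t + e) - P t)) \<partial>lborel)
        \<le> (\<integral>\<^sup>+t. w n (t + e) + indicator {-1..T + 1} t * ennreal c + w n t \<partial>lborel)"
      by (intro nn_integral_mono pw)
    also have "\<dots> = (\<integral>\<^sup>+t. w n t \<partial>lborel) + ennreal (T + 2) * ennreal c + (\<integral>\<^sup>+t. w n t \<partial>lborel)"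
      using T by (simp add: nn_integral_add nn_integral_shift nn_integral_multc add.commute)
    also have "\<dots> \<le> ennreal (\<epsilon> / 3) + ennreal (\<epsilon> / 3) + ennreal (\<epsilon> / 3)"
    proof (intro add_mono)
      show "ennreal (T + 2) * ennreal c \<le> ennreal (\<epsilon> / 3)"
      proof -
        have "(T + 2) * c = \<epsilon> / 3" using T by (simp add: c_def field_simps)
        then show ?thesis
          using T c ennreal_mult[of "T + 2" c] by (metis add_nonneg_nonneg less_imp_le order_refl zero_le_numeral)
      qed
    qed (use n in auto)
    also have "\<dots> = ennreal \<epsilon>"
      using \<epsilon> by (simp add: ennreal_plus[symmetric] del: ennreal_plus)
    finally show "(\<integral>\<^sup>+t. ennreal (norm (P (t + e) - P t)) \<partial>lborel) \<le> ennreal \<epsilon>" .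
  qed
qed

text \<open>
  The integrals below are over several variables at once and involve compositions such as
  \<open>u (t, h t + y)\<close>. Borel functions are stable under these operations, Lebesgue measurable ones
  are not.
\<close>

lemma borel_version:
  fixes f :: "'a::euclidean_space \<Rightarrow> real \<times> real"
  assumes f: "f \<in> borel_measurable (lebesgue_on S)" and S: "S \<in> sets borel"
    and K: "closed K" "0 \<in> K" and AE: "AE z in lebesgue_on S. f z \<in> K"
  obtains F where "F \<in> borel_measurable borel" "\<And>z. F z \<in> K" "\<And>z. z \<notin> S \<Longrightarrow> F z = 0"
    "AE z in lborel. z \<in> S \<longrightarrow> f z = F z"
proof -
  have S': "S \<in> sets lebesgue" using S by simp
  have m: "(\<lambda>z. if z \<in> S then f z else 0) \<in> borel_measurable lebesgue"
    using f S' by (simp add: borel_measurable_if)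
  have "(\<lambda>z. fst (if z \<in> S then f z else 0)) \<in> borel_measurable lebesgue"
    "(\<lambda>z. snd (if z \<in> S then f z else 0)) \<in> borel_measurable lebesgue"
    using m by (auto intro: borel_measurable_continuous_on[OF continuous_on_fst[OF continuous_on_id]]
        borel_measurable_continuous_on[OF continuous_on_snd[OF continuous_on_id]])
  then obtain f1 f2 where f1[measurable]: "f1 \<in> borel_measurable lborel" and a1: "AE z in lborel. fst (if z \<in> S then f z else 0) = f1 z"
    and f2[measurable]: "f2 \<in> borel_measurable lborel" and a2: "AE z in lborel. snd (if z \<in> S then f z else 0) = f2 z"
    using completion_ex_borel_measurable_real[of "\<lambda>z. fst (if z \<in> S then f z else 0)" lborel]
      completion_ex_borel_measurable_real[of "\<lambda>z. snd (if z \<in> S then f z else 0)" lborel]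
    by blast
  have [measurable]: "S \<in> sets borel" "K \<in> sets borel"
    using S K by auto
  define F where "F = (\<lambda>z. if z \<in> S \<and> (f1 z, f2 z) \<in> K then (f1 z, f2 z) else 0)"
  have "AE z in lborel. z \<in> S \<longrightarrow> f z \<in> K"
    using AE S' AE_completion_iff[of "\<lambda>z. z \<in> S \<longrightarrow> f z \<in> K" lborel] by (simp add: AE_restrict_space_iff)
  then have "AE z in lborel. z \<in> S \<longrightarrow> f z = F z"
    using a1 a2
  proof eventually_elim
    case (elim z)
    then have "f z = (f1 z, f2 z)" if "z \<in> S"
      using that by (simp add: prod_eq_iff)
    then show ?case
      using elim(1) by (simp add: F_def)
  qed
  moreover have "F \<in> borel_measurable borel"
  proof -
    have [measurable]: "f1 \<in> borel_measurable borel" "f2 \<in> borel_measurable borel"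
      using f1 f2 by simp_all
    show ?thesis unfolding F_def by measurable
  qed
  ultimately show thesis
    using K that[of F] by (auto simp: F_def)
qed

text \<open>
  The change of variables of the blow-up is a scaling composed with the shear that straightens the
  curve. A shear preserves the measure whatever \<open>h\<close> is.
\<close>

lemma lborel_blow_up:
  fixes h :: "real \<Rightarrow> real"
  assumes h[measurable]: "h \<in> borel_measurable borel" and \<epsilon>: "0 < \<epsilon>"
  shows "lborel = density (distr lborel borel (\<lambda>(s, y). (t0 + \<epsilon> * s, h (t0 + \<epsilon> * s) + \<epsilon> * y))) (\<lambda>_. ennreal (\<epsilon>\<^sup>2))"
    (is "_ = density (distr _ _ ?\<Phi>) _")
proof (rule measure_eqI)
  have \<Phi>[measurable]: "?\<Phi> \<in> borel_measurable borel"
    unfolding borel_prod[symmetric] by measurable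
  fix A :: "(real \<times> real) set" assume A: "A \<in> sets lborel"
  then have [measurable]: "A \<in> sets borel" by simp
  have "emeasure lborel A = (\<integral>\<^sup>+t. \<integral>\<^sup>+x. indicator A (t, x) \<partial>lborel \<partial>lborel)"
    using A by (simp add: lborel.nn_integral_fst lborel_prod)
  also have "\<dots> = (\<integral>\<^sup>+t. ennreal \<epsilon> * (\<integral>\<^sup>+y. indicator A (t, h t + \<epsilon> * y) \<partial>lborel) \<partial>lborel)"
  proof (intro nn_integral_cong)
    fix t
    show "(\<integral>\<^sup>+x. indicator A (t, x) \<partial>lborel) = ennreal \<epsilon> * (\<integral>\<^sup>+y. indicator A (t, h t + \<epsilon> * y) \<partial>lborel)"
      using \<epsilon> nn_integral_real_affine[of "\<lambda>x. indicator A (t, x)" \<epsilon> "h t"] by simp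
  qed
  also have "\<dots> = ennreal \<epsilon> * (\<integral>\<^sup>+s. ennreal \<epsilon> * (\<integral>\<^sup>+y. indicator A (t0 + \<epsilon> * s, h (t0 + \<epsilon> * s) + \<epsilon> * y) \<partial>lborel) \<partial>lborel)"
    using \<epsilon> by (subst nn_integral_real_affine[where c = \<epsilon> and t = t0]) auto
  also have "\<dots> = ennreal (\<epsilon>\<^sup>2) * (\<integral>\<^sup>+s. \<integral>\<^sup>+y. indicator A (?\<Phi> (s, y)) \<partial>lborel \<partial>lborel)"
    using \<epsilon> by (simp add: nn_integral_cmult power2_eq_square ennreal_mult mult.assoc)
  also have "\<dots> = ennreal (\<epsilon>\<^sup>2) * (\<integral>\<^sup>+z. indicator A (?\<Phi> z) \<partial>lborel)"
  proof (subst lborel.nn_integral_fst)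
    show "(\<lambda>z. indicator A (?\<Phi> z) :: ennreal) \<in> borel_measurable (lborel \<Otimes>\<^sub>M lborel)"
      unfolding lborel_prod by measurable
  qed (simp add: lborel_prod)
  also have "\<dots> = emeasure (density (distr lborel borel ?\<Phi>) (\<lambda>_. ennreal (\<epsilon>\<^sup>2))) A"
  proof -
    have "(\<integral>\<^sup>+z. indicator A (?\<Phi> z) \<partial>lborel) = (\<integral>\<^sup>+z. indicator A z \<partial>distr lborel borel ?\<Phi>)"
      by (subst nn_integral_distr) simp_all
    then show ?thesis
      by (simp add: emeasure_density_const)
  qed
  finally show "emeasure lborel A = emeasure (density (distr lborel borel ?\<Phi>) (\<lambda>_. ennreal (\<epsilon>\<^sup>2))) A" .
qed simp

lemma integral_blow_up:
  fixes h :: "real \<Rightarrow> real" and F :: "real \<times> real \<Rightarrow> real"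
  assumes h[measurable]: "h \<in> borel_measurable borel" and \<epsilon>: "0 < \<epsilon>" and F[measurable]: "F \<in> borel_measurable borel"
  shows "(LINT z|lborel. F z) = \<epsilon>\<^sup>2 * (LINT (s, y)|lborel. F (t0 + \<epsilon> * s, h (t0 + \<epsilon> * s) + \<epsilon> * y))"
proof -
  have [measurable]: "(\<lambda>(s, y). (t0 + \<epsilon> * s, h (t0 + \<epsilon> * s) + \<epsilon> * y)) \<in> borel_measurable (borel :: (real \<times> real) measure)"
    unfolding borel_prod[symmetric] by measurable
  show ?thesis
    using \<epsilon> by (subst lborel_blow_up[OF h \<epsilon>, of t0])
      (simp add: integral_density integral_distr prod.case_distrib[of F])
qed

section \<open>The jump inequality for a step function in the limit\<close>

lemma integrable_bounded_support:
  fixes f :: "'a::euclidean_space \<Rightarrow> real"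
  assumes [measurable]: "f \<in> borel_measurable borel" and bound: "\<And>x. x \<in> cbox a b \<Longrightarrow> \<bar>f x\<bar> \<le> c"
    and supp: "\<And>x. x \<notin> cbox a b \<Longrightarrow> f x = 0"
  shows "integrable lborel f"
proof (rule Bochner_Integration.integrable_bound)
  show "integrable lborel (\<lambda>x. indicator (cbox a b) x * c)"
    by (intro integrable_mult_left integrable_real_indicator) (use emeasure_lborel_cbox_finite in auto)
  show "AE x in lborel. norm (f x) \<le> norm (indicator (cbox a b) x * c)"
    using bound supp by (intro AE_I2) (force simp: indicator_def)
qed simp

lemma measurable_bump[measurable]: "bump \<in> borel_measurable borel" "bump' \<in> borel_measurable borel"
  using continuous_bump by (auto intro: borel_measurable_continuous_onI)

lemma bounded_bump: obtains c where "0 \<le> c" "\<And>x. \<bar>bump x\<bar> \<le> c" "\<And>x. \<bar>bump' x\<bar> \<le> c"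
proof -
  have "bounded (bump ` {-1..1})" "bounded (bump' ` {-1..1})"
    by (intro compact_imp_bounded compact_continuous_image continuous_bump compact_Icc)+
  then obtain c1 c2 where c: "\<And>x. x \<in> {-1..1} \<Longrightarrow> \<bar>bump x\<bar> \<le> c1" "\<And>x. x \<in> {-1..1} \<Longrightarrow> \<bar>bump' x\<bar> \<le> c2"
    unfolding bounded_iff by (auto simp del: atLeastAtMost_iff)
  define c where "c = max c1 c2"
  have "0 \<le> c" using c(1)[of 0] by (simp add: c_def)
  moreover have "\<bar>bump x\<bar> \<le> c \<and> \<bar>bump' x\<bar> \<le> c" for x
  proof (cases "x \<in> {-1..1}")
    case True
    then show ?thesis using c[OF True] by (auto simp: c_def)
  next
    case False
    then have "1 \<le> \<bar>x\<bar>" by auto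
    then show ?thesis using bump_eq_0 \<open>0 \<le> c\<close> by simp
  qed
  ultimately show thesis using that by blast
qed

lemma integrable_bump: "integrable lborel bump" "integrable lborel bump'"
proof -
  obtain c where "\<And>x. \<bar>bump x\<bar> \<le> c" "\<And>x. \<bar>bump' x\<bar> \<le> c" using bounded_bump by metis
  then show "integrable lborel bump" "integrable lborel bump'"
    by (auto intro!: integrable_bounded_support[of _ "-1" 1 c] bump_eq_0)
qed

text \<open>
  The step function contributes the value of \<open>bump\<close> at the jump, by the fundamental theorem of
  calculus on either side of it.
\<close>

lemma integral_step_bump':
  "integrable lborel (\<lambda>y. (if 0 < y then a else b) * bump' y)"
  "(LINT y|lborel. (if 0 < y then a else b) * bump' y) = (b - a) * bump 0"
proof -
  have "has_bochner_integral lborel (\<lambda>x. bump' x * indicator {-1..0} x) (bump 0 - bump (-1))"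
    "has_bochner_integral lborel (\<lambda>x. bump' x * indicator {0..1} x) (bump 1 - bump 0)"
    using continuous_bump(2)[of UNIV]
    by (intro has_bochner_integral_FTC_Icc_real bump_DERIV; simp add: continuous_on_eq_continuous_at)+
  then have "has_bochner_integral lborel (\<lambda>y. a * (bump' y * indicator {0..1} y) + b * (bump' y * indicator {-1..0} y))
      (a * (bump 1 - bump 0) + b * (bump 0 - bump (-1)))"
    by (intro has_bochner_integral_add has_bochner_integral_mult_right)
  moreover have "AE y in lborel. a * (bump' y * indicator {0..1} y) + b * (bump' y * indicator {-1..0} y)
      = (if 0 < y then a else b) * bump' y"
    using AE_lborel_singleton[of "0::real"]
    by eventually_elim (auto simp: indicator_def bump_eq_0(2))
  ultimately have "has_bochner_integral lborel (\<lambda>y. (if 0 < y then a else b) * bump' y)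
      (a * (bump 1 - bump 0) + b * (bump 0 - bump (-1)))"
    by (subst has_bochner_integral_cong_AE[symmetric]) auto
  then show "integrable lborel (\<lambda>y. (if 0 < y then a else b) * bump' y)"
    "(LINT y|lborel. (if 0 < y then a else b) * bump' y) = (b - a) * bump 0"
    by (auto simp: has_bochner_integral_iff bump_eq_0 algebra_simps)
qed

lemma integral_bump_pos: "0 < (LINT y|lborel. bump y)"
proof -
  have "(LINT y|lborel. bump y) \<noteq> 0"
  proof
    assume "(LINT y|lborel. bump y) = 0"
    then have "AE y in lborel. bump y = 0"
      using integral_nonneg_eq_0_iff_AE[OF integrable_bump(1)] bump_nonneg by simp
    then have "AE y in lborel. y \<notin> {-1<..<1::real}"
    proof eventually_elim
      case (elim y)
      then show ?case using bump_pos[of y] by (auto simp: abs_less_iff)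
    qed
    then have "{-1<..<1::real} \<in> null_sets lborel"
      by (subst AE_iff_null_sets) auto
    then show False by (simp add: null_sets_def)
  qed
  moreover have "0 \<le> (LINT y|lborel. bump y)"
    by (intro integral_nonneg_AE AE_I2 bump_nonneg)
  ultimately show ?thesis by simp
qed

text \<open>
  Only Lebesgue measurability of the integrand is known, and this through its agreement almost
  everywhere with \<open>F\<close>, as \<open>w\<close> may be a composition with a function that is not Borel.
\<close>

lemma weak_div_borel:
  assumes F: "F \<in> borel_measurable borel" and F0: "\<And>z. z \<notin> space_time \<Longrightarrow> F z = 0"
    and AE: "AE z in lborel. z \<in> space_time \<longrightarrow>
      w z * frechet_derivative \<phi> (at z) (1, 0) + g z * frechet_derivative \<phi> (at z) (0, 1) = F z"
  shows "weak_div w g \<phi> = - (LINT z|lborel. F z)"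
proof -
  let ?f = "\<lambda>z. w z * frechet_derivative \<phi> (at z) (1, 0) + g z * frechet_derivative \<phi> (at z) (0, 1)"
  have st: "space_time \<in> sets lebesgue"
    unfolding space_time_def by (intro sets_completionI_sets) (simp add: open_Times borel_open)
  have AE': "AE z in lebesgue. F z = indicator space_time z *\<^sub>R ?f z"
    using AE_completion[OF AE] F0 by (auto simp: indicator_def elim!: eventually_mono)
  have F': "F \<in> borel_measurable lebesgue"
    using F by (simp add: measurable_completion)
  have "(LINT z|lebesgue_on space_time. ?f z) = (LINT z|lebesgue. indicator space_time z *\<^sub>R ?f z)"
    using st by (intro integral_restrict_space) simp
  also have "\<dots> = (LINT z|lebesgue. F z)"
    using AE' F' borel_measurable_AE[OF F' AE'] by (intro integral_cong_AE) auto
  also have "\<dots> = (LINT z|lborel. F z)"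
    using F by (intro integral_completion) simp
  finally show ?thesis by (simp add: weak_div_def)
qed

text \<open>
  The states with density and velocity bounded by \<open>M\<close>. The velocity bound is multiplied by \<open>\<rho>\<close> so that
  the set contains the vacuum state and is compact.
\<close>

definition state_cone :: "real \<Rightarrow> (real \<times> real) set" where
  "state_cone M = {(\<rho>, m). 0 \<le> \<rho> \<and> \<rho> \<le> M \<and> \<bar>m\<bar> \<le> M * \<rho>}"

lemma compact_state_cone: "compact (state_cone M)"
proof -
  have eq: "state_cone M = {z. 0 \<le> fst z} \<inter> {z. fst z \<le> M} \<inter> {z. \<bar>snd z\<bar> \<le> M * fst z}"
    by (auto simp: state_cone_def)
  have "closed (state_cone M)"
    unfolding eq by (intro closed_Int closed_Collect_le continuous_intros)
  moreover have "bounded (state_cone M)"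
  proof (rule bounded_subset[OF bounded_cbox])
    show "state_cone M \<subseteq> cbox (0, - (M * M)) (M, M * M)"
    proof
      fix z assume z: "z \<in> state_cone M"
      then have "M * fst z \<le> M * M" by (intro mult_left_mono) (auto simp: state_cone_def)
      then show "z \<in> cbox (0, - (M * M)) (M, M * M)"
        using z by (cases z) (auto simp: state_cone_def abs_le_iff cbox_Pair_eq)
    qed
  qed
  ultimately show ?thesis by (simp add: compact_eq_bounded_closed)
qed

text \<open>
  The weak inequality is tested with \<open>moving_bump (e n) t0 (h t0) \<sigma>\<close> and written in the variables
  \<open>(s, y)\<close> of the blow-up, where the integrands \<open>f n\<close> are bounded, vanish off a fixed rectangle and
  converge almost everywhere. Their limit \<open>flim\<close> is integrated by Fubini's theorem: the
  terms with \<open>bump' s\<close> have integral \<open>0\<close>, and the others leave the jump of \<open>g - \<sigma> * w\<close> times the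
  positive number \<open>(\<integral> bump) * bump 0\<close>.
\<close>

lemma jump_inequality_of_blow_up:
  fixes u U :: "real \<times> real \<Rightarrow> real \<times> real" and w g :: "real \<times> real \<Rightarrow> real" and e :: "nat \<Rightarrow> real"
  assumes U[measurable]: "U \<in> borel_measurable borel" and UK: "\<And>z. U z \<in> state_cone M"
    and uU: "AE z in lborel. z \<in> space_time \<longrightarrow> u z = U z"
    and lip: "C-lipschitz_on UNIV h" and der: "(h has_real_derivative \<sigma>) (at t0)" and \<sigma>: "\<bar>\<sigma>\<bar> \<le> C"
    and t0: "0 < t0" and e0: "\<And>n. 0 < e n" and e: "e \<longlonglongrightarrow> 0"
    and w: "continuous_on (state_cone M) w" and g: "continuous_on (state_cone M) g"
    and uLR: "uL \<in> state_cone M" "uR \<in> state_cone M"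
    and conv: "AE z in lborel. \<bar>fst z\<bar> \<le> 1 \<and> \<bar>snd z\<bar> \<le> 1 + 2 * C \<longrightarrow>
      (\<lambda>n. U (t0 + e n * fst z, h (t0 + e n * fst z) + e n * snd z)) \<longlonglongrightarrow> (if 0 < snd z then uR else uL)"
    and weak: "\<And>n. e n < t0 \<Longrightarrow> weak_div (w \<circ> u) (g \<circ> u) (moving_bump (e n) t0 (h t0) \<sigma>) \<le> 0"
  shows "g uR - g uL \<le> \<sigma> * (w uR - w uL)"
proof -
  \<comment> \<open>The test function lives on \<open>\<bar>s\<bar> \<le> 1\<close>, \<open>\<bar>y + \<kappa> n s\<bar> \<le> 1\<close>, and \<open>\<bar>\<kappa> n s\<bar> \<le> 2 * C\<close> there.\<close>
  define R where "R = 1 + 2 * C"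
  have C0: "0 \<le> C" using lip lipschitz_on_nonneg by blast
  have [measurable]: "h \<in> borel_measurable borel"
    using lipschitz_on_continuous_on[OF lip] by (rule borel_measurable_continuous_onI)
  have mK: "(\<lambda>z. f (U z)) \<in> borel_measurable borel" if "continuous_on (state_cone M) f" for f :: "real \<times> real \<Rightarrow> real"
  proof -
    have "(\<lambda>x. indicator (state_cone M) x *\<^sub>R f x) \<in> borel_measurable borel"
      using compact_imp_closed[OF compact_state_cone] that
      by (intro borel_measurable_continuous_on_indicator) auto
    from measurable_compose[OF U this] show ?thesis using UK by simp
  qed
  note [measurable] = mK[OF w] mK[OF g]
  \<comment> \<open>\<open>\<kappa> n s\<close> is the rescaled distance of the curve from its tangent.\<close>
  define \<kappa> where "\<kappa> = (\<lambda>n s. (h (t0 + e n * s) - h t0 - \<sigma> * (e n * s)) / e n)"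
  define V where "V = (\<lambda>n s y. U (t0 + e n * s, h (t0 + e n * s) + e n * y))"
  define f where "f = (\<lambda>n (s, y). w (V n s y) * (bump' s * bump (y + \<kappa> n s) - \<sigma> * bump s * bump' (y + \<kappa> n s))
      + g (V n s y) * (bump s * bump' (y + \<kappa> n s)))"
  define wy where "wy = (\<lambda>y::real. if 0 < y then w uR else w uL)"
  define gy where "gy = (\<lambda>y::real. if 0 < y then g uR else g uL)"
  define flim where "flim = (\<lambda>(s, y). wy y * (bump' s * bump y - \<sigma> * bump s * bump' y) + gy y * (bump s * bump' y))"
  have f_meas: "f n \<in> borel_measurable borel" for n
    unfolding f_def V_def \<kappa>_def borel_prod[symmetric] by measurable
  have flim_meas: "flim \<in> borel_measurable borel"
    unfolding flim_def wy_def gy_def borel_prod[symmetric] by measurable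
  have nonneg: "0 \<le> (LINT z|lborel. f n z)" if n: "e n < t0" for n
  proof -
    define F where "F = (\<lambda>(t, x). w (U (t, x)) * ((bump' ((t - t0) / e n) * bump ((x - h t0 - \<sigma> * (t - t0)) / e n)
        - \<sigma> * bump ((t - t0) / e n) * bump' ((x - h t0 - \<sigma> * (t - t0)) / e n)) / e n)
        + g (U (t, x)) * (bump ((t - t0) / e n) * bump' ((x - h t0 - \<sigma> * (t - t0)) / e n) / e n))"
    have F_meas: "F \<in> borel_measurable borel"
      unfolding F_def borel_prod[symmetric] by measurable
    have "weak_div (w \<circ> u) (g \<circ> u) (moving_bump (e n) t0 (h t0) \<sigma>) = - (LINT z|lborel. F z)"
    proof (rule weak_div_borel[OF F_meas])
      fix z :: "real \<times> real" assume "z \<notin> space_time"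
      then have "fst z \<le> 0" by (cases z) (auto simp: space_time_def)
      then have "1 \<le> \<bar>(fst z - t0) / e n\<bar>"
        using n e0[of n] by (simp add: abs_divide le_divide_eq)
      then show "F z = 0"
        using bump_eq_0 by (simp add: F_def case_prod_beta')
    next
      show "AE z in lborel. z \<in> space_time \<longrightarrow>
        (w \<circ> u) z * frechet_derivative (moving_bump (e n) t0 (h t0) \<sigma>) (at z) (1, 0)
        + (g \<circ> u) z * frechet_derivative (moving_bump (e n) t0 (h t0) \<sigma>) (at z) (0, 1) = F z"
        using uU
      proof eventually_elim
        case (elim z)
        have "e n \<noteq> 0" using e0[of n] by simp
        then show ?case
          using elim moving_bump_derivative[of "e n" t0 "h t0" \<sigma> "fst z" "snd z"]
          by (auto simp: F_def case_prod_beta')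
      qed
    qed
    then have "0 \<le> (LINT z|lborel. F z)"
      using weak[OF n] by simp
    also have "(LINT z|lborel. F z) = (e n)\<^sup>2 * (LINT (s, y)|lborel. F (t0 + e n * s, h (t0 + e n * s) + e n * y))"
      by (rule integral_blow_up[OF _ e0 F_meas]) measurable
    also have "(\<lambda>(s, y). F (t0 + e n * s, h (t0 + e n * s) + e n * y)) = (\<lambda>z. f n z / e n)"
    proof -
      have "(h (t0 + e n * s) + e n * y - h t0 - \<sigma> * (e n * s)) / e n = y + \<kappa> n s" for s y
        using e0[of n] by (simp add: \<kappa>_def field_simps)
      then show ?thesis
        using e0[of n] by (auto simp: F_def f_def V_def fun_eq_iff add_divide_distrib)
    qed
    finally have "0 \<le> (e n)\<^sup>2 * (LINT z|lborel. f n z / e n)" .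
    then show ?thesis
      using e0[of n] by (simp add: zero_le_mult_iff zero_le_divide_iff power2_eq_square)
  qed
  have \<kappa>_bound: "\<bar>\<kappa> n s\<bar> \<le> 2 * C" if "\<bar>s\<bar> \<le> 1" for n s
  proof -
    have "\<bar>h (t0 + e n * s) - h t0\<bar> \<le> C * (e n * \<bar>s\<bar>)"
      using lipschitz_onD[OF lip, of "t0 + e n * s" t0] e0[of n] by (simp add: dist_real_def abs_mult)
    moreover have "\<bar>\<sigma> * (e n * s)\<bar> \<le> C * (e n * \<bar>s\<bar>)"
      using \<sigma> e0[of n] by (simp add: abs_mult mult_right_mono)
    moreover have "C * (e n * \<bar>s\<bar>) \<le> C * (e n * 1)"
      using that C0 e0[of n] by (intro mult_left_mono) auto
    ultimately have "\<bar>h (t0 + e n * s) - h t0 - \<sigma> * (e n * s)\<bar> \<le> 2 * C * e n"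
      by linarith
    then show ?thesis
      using e0[of n] by (simp add: \<kappa>_def abs_divide pos_divide_le_eq)
  qed
  have \<kappa>_lim: "(\<lambda>n. \<kappa> n s) \<longlonglongrightarrow> 0" for s
  proof (cases "s = 0")
    case True
    then show ?thesis by (simp add: \<kappa>_def)
  next
    case False
    have "(\<lambda>n. e n * s) \<longlonglongrightarrow> 0 * s"
      by (intro tendsto_intros e)
    then have "filterlim (\<lambda>n. e n * s) (at 0) sequentially"
      using False e0 by (auto simp: filterlim_at intro!: always_eventually) (metis less_irrefl)
    from filterlim_compose[OF DERIV_D[OF der] this]
    have "(\<lambda>n. s * ((h (t0 + e n * s) - h t0) / (e n * s)) - \<sigma> * s) \<longlonglongrightarrow> s * \<sigma> - \<sigma> * s"
      by (intro tendsto_intros)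
    moreover have "s * ((h (t0 + e n * s) - h t0) / (e n * s)) - \<sigma> * s = \<kappa> n s" for n
    proof -
      have "e n \<noteq> 0" using e0[of n] by simp
      then show ?thesis using False by (simp add: \<kappa>_def field_simps)
    qed
    ultimately show ?thesis by (simp add: mult.commute)
  qed
  obtain c where c: "0 \<le> c" "\<And>x. \<bar>bump x\<bar> \<le> c" "\<And>x. \<bar>bump' x\<bar> \<le> c" using bounded_bump by metis
  have "bounded (w ` state_cone M)" "bounded (g ` state_cone M)"
    by (intro compact_imp_bounded compact_continuous_image w g compact_state_cone)+
  then obtain W G where WG: "\<And>z. z \<in> state_cone M \<Longrightarrow> \<bar>w z\<bar> \<le> W" "\<And>z. z \<in> state_cone M \<Longrightarrow> \<bar>g z\<bar> \<le> G"
    unfolding bounded_iff by auto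
  define c' where "c' = W * (c * c + C * c * c) + G * (c * c)"
  have bound: "\<bar>a * (b' * b1 - \<sigma> * b * b1') + d * (b * b1')\<bar> \<le> c'"
    if ab: "\<bar>a\<bar> \<le> W" "\<bar>d\<bar> \<le> G" "\<bar>b\<bar> \<le> c" "\<bar>b'\<bar> \<le> c" "\<bar>b1\<bar> \<le> c" "\<bar>b1'\<bar> \<le> c" for a b b' b1 b1' d
  proof -
    have "\<bar>b' * b1\<bar> \<le> c * c" "\<bar>b * b1'\<bar> \<le> c * c"
      using ab c(1) by (auto simp: abs_mult intro!: mult_mono)
    moreover have "\<bar>\<sigma> * b * b1'\<bar> \<le> C * c * c"
      using ab c(1) C0 \<sigma> by (auto simp: abs_mult intro!: mult_mono)
    ultimately have "\<bar>b' * b1 - \<sigma> * b * b1'\<bar> \<le> c * c + C * c * c" by linarith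
    then have "\<bar>a * (b' * b1 - \<sigma> * b * b1')\<bar> \<le> W * (c * c + C * c * c)"
      using ab by (auto simp: abs_mult intro!: mult_mono)
    moreover have "\<bar>d * (b * b1')\<bar> \<le> G * (c * c)"
      unfolding abs_mult[of d] using ab \<open>\<bar>b * b1'\<bar> \<le> c * c\<close> by (intro mult_mono) auto
    ultimately show ?thesis unfolding c'_def by linarith
  qed
  define dom where "dom = (\<lambda>z::real \<times> real. indicator (cbox (-1, -R) (1, R)) z * c')"
  have dom_int: "integrable lborel dom"
    unfolding dom_def
    by (intro integrable_mult_left integrable_real_indicator) (use emeasure_lborel_cbox_finite in auto)
  have dominated: "\<bar>f n z\<bar> \<le> dom z" for n z
  proof (cases z)
    case (Pair s y)
    show ?thesis
    proof (cases "z \<in> cbox (-1, -R) (1, R)")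
      case True
      have "V n s y \<in> state_cone M" by (simp add: V_def UK)
      then show ?thesis
        using bound[OF WG(1) WG(2) c(2) c(3) c(2) c(3)] True by (simp add: f_def dom_def Pair)
    next
      case False
      then have "1 < \<bar>s\<bar> \<or> \<bar>s\<bar> \<le> 1 \<and> R < \<bar>y\<bar>"
        by (auto simp: Pair cbox_Pair_eq)
      then have "bump s = 0 \<and> bump' s = 0 \<or> bump (y + \<kappa> n s) = 0 \<and> bump' (y + \<kappa> n s) = 0"
      proof
        assume "\<bar>s\<bar> \<le> 1 \<and> R < \<bar>y\<bar>"
        then have "1 \<le> \<bar>y + \<kappa> n s\<bar>"
          using \<kappa>_bound[of s n] by (auto simp: R_def)
        then show ?thesis using bump_eq_0 by blast
      qed (use bump_eq_0 in auto)
      then show ?thesis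
        using False by (auto simp: f_def dom_def Pair)
    qed
  qed
  have ptw: "AE z in lborel. (\<lambda>n. f n z) \<longlonglongrightarrow> flim z"
    using conv
  proof eventually_elim
    case (elim z)
    obtain s y where z: "z = (s, y)" by fastforce
    have lim_shift: "(\<lambda>n. bump (y + \<kappa> n s)) \<longlonglongrightarrow> bump y" "(\<lambda>n. bump' (y + \<kappa> n s)) \<longlonglongrightarrow> bump' y"
    proof -
      have "(\<lambda>n. y + \<kappa> n s) \<longlonglongrightarrow> y + 0" by (intro tendsto_intros \<kappa>_lim)
      then have y: "(\<lambda>n. y + \<kappa> n s) \<longlonglongrightarrow> y" by simp
      have "isCont bump y" "isCont bump' y"
        using continuous_bump[of UNIV] by (auto simp: continuous_on_eq_continuous_at)
      then show "(\<lambda>n. bump (y + \<kappa> n s)) \<longlonglongrightarrow> bump y" "(\<lambda>n. bump' (y + \<kappa> n s)) \<longlonglongrightarrow> bump' y"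
        using y isCont_tendsto_compose by blast+
    qed
    show ?case
    proof (cases "\<bar>s\<bar> \<le> 1 \<and> \<bar>y\<bar> \<le> R")
      case True
      then have V_lim: "(\<lambda>n. V n s y) \<longlonglongrightarrow> (if 0 < y then uR else uL)"
        using elim by (simp add: z V_def R_def)
      have in_cone: "(if 0 < y then uR else uL) \<in> state_cone M" "\<forall>\<^sub>F n in sequentially. V n s y \<in> state_cone M"
        using uLR by (simp_all add: V_def UK)
      have "(\<lambda>n. w (V n s y)) \<longlonglongrightarrow> wy y" "(\<lambda>n. g (V n s y)) \<longlonglongrightarrow> gy y"
        using continuous_on_tendsto_compose[OF w V_lim in_cone] continuous_on_tendsto_compose[OF g V_lim in_cone]
        by (simp_all add: wy_def gy_def if_distrib[of w] if_distrib[of g])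
      then show ?thesis
        unfolding f_def flim_def z by (auto intro!: tendsto_intros lim_shift)
    next
      case False
      then have "z \<notin> cbox (-1, -R) (1, R)"
        by (auto simp: z cbox_Pair_eq abs_le_iff)
      then have "f n z = 0" for n
        using dominated[of n z] by (simp add: dom_def)
      moreover have "flim z = 0"
      proof -
        have "1 \<le> \<bar>s\<bar> \<or> 1 \<le> \<bar>y\<bar>" using False C0 by (auto simp: R_def)
        then show ?thesis using bump_eq_0 by (auto simp: flim_def z)
      qed
      ultimately show ?thesis by simp
    qed
  qed
  have flim_int: "integrable lborel flim" and lim: "(\<lambda>n. LINT z|lborel. f n z) \<longlonglongrightarrow> (LINT z|lborel. flim z)"
    using f_meas flim_meas dom_int ptw dominated
    by (auto intro!: integrable_dominated_convergence[where w = dom and s = f] integral_dominated_convergence[where w = dom])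
  have "0 \<le> (LINT z|lborel. flim z)"
  proof (rule tendsto_lowerbound[OF lim])
    show "\<forall>\<^sub>F n in sequentially. 0 \<le> (LINT z|lborel. f n z)"
      using order_tendstoD(2)[OF e t0] by (rule eventually_mono) (rule nonneg)
  qed simp
  also have "(LINT z|lborel. flim z) = (LINT s|lborel. LINT y|lborel. flim (s, y))"
    using lborel_pair.integral_fst'[of flim] flim_int by (simp add: lborel_prod)
  also have "\<dots> = (LINT s|lborel. bump' s * (LINT y|lborel. wy y * bump y)
      + bump s * (((g uL - \<sigma> * w uL) - (g uR - \<sigma> * w uR)) * bump 0))"
  proof (rule Bochner_Integration.integral_cong)
    fix s
    define j where "j = (\<lambda>y::real. (if 0 < y then g uR - \<sigma> * w uR else g uL - \<sigma> * w uL) * bump' y)"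
    have "flim (s, y) = bump' s * (wy y * bump y) + bump s * j y" for y
      by (simp add: flim_def j_def wy_def gy_def algebra_simps)
    moreover have "integrable lborel (\<lambda>y. wy y * bump y)"
    proof (rule integrable_bounded_support[of _ "-1" 1 "W * c"])
      show "\<bar>wy y * bump y\<bar> \<le> W * c" for y
        unfolding abs_mult wy_def using WG(1)[OF uLR(1)] WG(1)[OF uLR(2)] c by (intro mult_mono) auto
      show "wy y * bump y = 0" if "y \<notin> cbox (-1) 1" for y
        using that bump_eq_0(1)[of y] by auto
    qed (simp add: wy_def)
    ultimately show "(LINT y|lborel. flim (s, y)) = bump' s * (LINT y|lborel. wy y * bump y)
      + bump s * (((g uL - \<sigma> * w uL) - (g uR - \<sigma> * w uR)) * bump 0)"
      using integral_step_bump'[of "g uR - \<sigma> * w uR" "g uL - \<sigma> * w uL"]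
      by (simp add: j_def)
  qed simp
  also have "\<dots> = (LINT y|lborel. bump y) * (((g uL - \<sigma> * w uL) - (g uR - \<sigma> * w uR)) * bump 0)"
    using integral_step_bump'(2)[of 1 1] by (simp add: integrable_bump)
  finally have "0 \<le> (LINT y|lborel. bump y) * (((g uL - \<sigma> * w uL) - (g uR - \<sigma> * w uR)) * bump 0)" .
  then have "0 \<le> (g uL - \<sigma> * w uL) - (g uR - \<sigma> * w uR)"
    using integral_bump_pos bump_pos[of 0] by (simp add: zero_le_mult_iff)
  then show ?thesis by (simp add: algebra_simps)
qed

section \<open>Blow-up at almost every point of the curve\<close>

text \<open>
  A null set of the plane is also null in the coordinates that are straightened along the curve, so
  Fubini's theorem applies to the parallel curves. Here \<open>c = 1\<close> and \<open>c = -1\<close> serve for the two sides.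
\<close>

lemma AE_along_curve:
  fixes h :: "real \<Rightarrow> real" and c :: real
  assumes h[measurable]: "h \<in> borel_measurable borel" and c: "c \<noteq> 0"
    and AE: "AE z in lborel. R (z :: real \<times> real)"
  shows "AE y in lborel. AE t in lborel. R (t, h t + c * y)"
proof -
  obtain N where N: "\<And>z. z \<notin> N \<Longrightarrow> R z" "N \<in> null_sets lborel"
    using AE_E3[OF AE] by auto
  have [measurable]: "N \<in> sets borel" using N(2) by auto
  have "AE z in lborel \<Otimes>\<^sub>M lborel. z \<notin> N"
    unfolding lborel_prod by (rule AE_not_in[OF N(2)])
  then have "AE t in lborel. AE x in lborel. (t, x) \<notin> N"
    by (rule lborel_pair.AE_pair)
  then have "AE t in lborel. AE y in lborel. (t, h t + c * y) \<notin> N"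
  proof eventually_elim
    case (elim t)
    then show ?case by (intro AE_borel_affine[OF c]) simp_all
  qed
  moreover have "{z \<in> space (lborel \<Otimes>\<^sub>M lborel). (fst z, h (fst z) + c * snd z) \<notin> N} \<in> sets (lborel \<Otimes>\<^sub>M lborel)"
    by measurable
  ultimately have "AE y in lborel. AE t in lborel. (t, h t + c * y) \<notin> N"
    using lborel_pair.AE_commute[of "\<lambda>t y. (t, h t + c * y) \<notin> N"] by simp
  then show ?thesis
    by eventually_elim (auto elim!: eventually_mono intro: N(1))
qed

text \<open>
  The trace condition in a form with a single \<open>y\<close> of either sign and with Borel versions of all the
  functions.
\<close>

lemma strong_traces_L1:
  fixes u U :: "real \<times> real \<Rightarrow> real \<times> real" and h h0 :: "real \<Rightarrow> real" and P Q :: "real \<Rightarrow> real \<times> real"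
  assumes tr: "strong_traces T u h0 u_plus u_minus"
    and [measurable]: "U \<in> borel_measurable borel" "P \<in> borel_measurable borel" "Q \<in> borel_measurable borel" "h \<in> borel_measurable borel"
    and uU: "AE z in lborel. z \<in> space_time \<longrightarrow> u z = U z"
    and P: "AE t in lborel. t \<in> {0..T} \<longrightarrow> u_plus t = P t" and Q: "AE t in lborel. t \<in> {0..T} \<longrightarrow> u_minus t = Q t"
    and h: "\<And>t. t \<in> {0..T} \<Longrightarrow> h0 t = h t" and \<epsilon>: "0 < \<epsilon>"
  shows "\<exists>\<delta>>0. AE y in lborel. \<bar>y\<bar> < \<delta> \<longrightarrow>
    (\<integral>\<^sup>+t. indicator {0..T} t * ennreal (norm (U (t, h t + y) - (if 0 < y then P t else Q t))) \<partial>lborel) \<le> ennreal \<epsilon>"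
proof -
  define E where "E = (\<lambda>y. \<integral>\<^sup>+t. ennreal (norm (u (t, h0 t + y) - u_plus t) + norm (u (t, h0 t - y) - u_minus t))
          \<partial>lebesgue_on {0..T})"
  have "(\<lambda>k. esssup (lebesgue_on {0<..<1 / real k}) E) \<longlonglongrightarrow> 0"
    using tr unfolding strong_traces_def E_def by simp
  then have "\<forall>\<^sub>F k in sequentially. esssup (lebesgue_on {0<..<1 / real k}) E < ennreal \<epsilon>"
    using \<epsilon> by (intro order_tendstoD) auto
  then have "\<forall>\<^sub>F k in sequentially. esssup (lebesgue_on {0<..<1 / real k}) E < ennreal \<epsilon> \<and> 0 < k"
    using eventually_gt_at_top[of 0] by eventually_elim simp
  then obtain k where k: "esssup (lebesgue_on {0<..<1 / real k}) E < ennreal \<epsilon>" "0 < k"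
    using eventually_happens' trivial_limit_sequentially by blast
  define \<delta> where "\<delta> = 1 / real k"
  have "AE y in lebesgue_on {0<..<\<delta>}. E y \<le> ennreal \<epsilon>"
    using esssup_AE[of E "lebesgue_on {0<..<1 / real k}"] unfolding \<delta>_def
  proof eventually_elim
    case (elim y)
    then show ?case using k(1) by simp
  qed
  then have E: "AE y in lborel. y \<in> {0<..<\<delta>} \<longrightarrow> E y \<le> ennreal \<epsilon>"
    by (simp add: AE_restrict_space_iff AE_completion_iff)
  define gP where "gP = (\<lambda>y. \<integral>\<^sup>+t. indicator {0..T} t * ennreal (norm (U (t, h t + y) - P t)) \<partial>lborel)"
  define gQ where "gQ = (\<lambda>y. \<integral>\<^sup>+t. indicator {0..T} t * ennreal (norm (U (t, h t + y) - Q t)) \<partial>lborel)"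
  have [measurable]: "gQ \<in> borel_measurable borel"
    unfolding gQ_def by measurable
  have E_eq: "E y = (\<integral>\<^sup>+t. ennreal (norm (u (t, h0 t + y) - u_plus t) + norm (u (t, h0 t - y) - u_minus t)) * indicator {0..T} t \<partial>lborel)" for y
    unfolding E_def by (subst nn_integral_restrict_space) (simp_all add: nn_integral_completion)
  have "AE y in lborel. AE t in lborel. (t, h t + 1 * y) \<in> space_time \<longrightarrow> u (t, h t + 1 * y) = U (t, h t + 1 * y)"
    by (rule AE_along_curve[OF _ _ uU]) simp_all
  moreover have "AE y in lborel. AE t in lborel. (t, h t + (-1) * y) \<in> space_time \<longrightarrow> u (t, h t + (-1) * y) = U (t, h t + (-1) * y)"
    by (rule AE_along_curve[OF _ _ uU]) simp_all
  ultimately have both: "AE y in lborel. gP y \<le> E y \<and> gQ (- y) \<le> E y"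
  proof eventually_elim
    case (elim y)
    have *: "AE t in lborel. t \<in> {0..T} \<longrightarrow> u (t, h0 t + y) - u_plus t = U (t, h t + y) - P t \<and>
        u (t, h0 t - y) - u_minus t = U (t, h t - y) - Q t"
      using elim P Q AE_lborel_singleton[of "0::real"]
      by eventually_elim (auto simp: space_time_def h)
    have "gP y \<le> E y"
      unfolding gP_def E_eq using * by (intro nn_integral_mono_AE) (auto simp: indicator_def elim!: eventually_mono)
    moreover have "gQ (- y) \<le> E y"
      unfolding gQ_def E_eq using * by (intro nn_integral_mono_AE) (auto simp: indicator_def elim!: eventually_mono)
    ultimately show ?case ..
  qed
  have gP: "AE y in lborel. y \<in> {0<..<\<delta>} \<longrightarrow> gP y \<le> ennreal \<epsilon>"
    using both E by eventually_elim auto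
  have gQ': "AE y in lborel. y \<in> {0<..<\<delta>} \<longrightarrow> gQ (- y) \<le> ennreal \<epsilon>"
    using both E by eventually_elim auto
  have "AE y in lborel. 0 + (- 1) * y \<in> {0<..<\<delta>} \<longrightarrow> gQ (- (0 + (- 1) * y)) \<le> ennreal \<epsilon>"
    by (rule AE_borel_affine[OF _ _ gQ']) simp_all
  then have "AE y in lborel. \<bar>y\<bar> < \<delta> \<longrightarrow>
    (\<integral>\<^sup>+t. indicator {0..T} t * ennreal (norm (U (t, h t + y) - (if 0 < y then P t else Q t))) \<partial>lborel) \<le> ennreal \<epsilon>"
    using gP AE_lborel_singleton[of "0::real"]
  proof eventually_elim
    case (elim y)
    then show ?case by (cases "0 < y") (auto simp: gP_def gQ_def)
  qed
  moreover have "0 < \<delta>" using k(2) by (simp add: \<delta>_def)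
  ultimately show ?thesis by blast
qed

text \<open>
  For fixed \<open>(s, y)\<close>, the integrand compares \<open>U\<close> at time \<open>t0 + e * s\<close> with the trace at time \<open>t0\<close>. Passing
  through the trace at time \<open>t0 + e * s\<close> splits the error, and after integration over \<open>t0\<close> the first
  part is the trace condition at distance \<open>e * y\<close> and the second a translation by \<open>e * s\<close>.
\<close>

lemma blow_up_L1:
  fixes U :: "real \<times> real \<Rightarrow> real \<times> real" and h :: "real \<Rightarrow> real" and P Q :: "real \<Rightarrow> real \<times> real"
  assumes [measurable]: "U \<in> borel_measurable borel" "P \<in> borel_measurable borel" "Q \<in> borel_measurable borel" "h \<in> borel_measurable borel"
    and P: "\<And>t. norm (P t) \<le> B" "\<And>t. t \<notin> {0..T} \<Longrightarrow> P t = 0"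
    and Q: "\<And>t. norm (Q t) \<le> B" "\<And>t. t \<notin> {0..T} \<Longrightarrow> Q t = 0"
    and tr: "\<And>\<epsilon>. 0 < \<epsilon> \<Longrightarrow> \<exists>\<delta>>0. AE y in lborel. \<bar>y\<bar> < \<delta> \<longrightarrow>
      (\<integral>\<^sup>+t. indicator {0..T} t * ennreal (norm (U (t, h t + y) - (if 0 < y then P t else Q t))) \<partial>lborel) \<le> ennreal \<epsilon>"
    and R: "1 \<le> R" and \<epsilon>: "0 < \<epsilon>"
  shows "\<exists>d>0. \<forall>e. 0 < e \<and> e < d \<longrightarrow>
    (\<integral>\<^sup>+(t0, s, y). ennreal (indicator {0..T} (t0 + e * s) * indicator {-1..1} s * indicator {-R..R} y *
        norm (U (t0 + e * s, h (t0 + e * s) + e * y) - (if 0 < y then P t0 else Q t0))) \<partial>lborel) \<le> ennreal \<epsilon>"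
proof -
  \<comment> \<open>Three errors of size \<open>\<epsilon>'\<close> are integrated over a rectangle of area \<open>4 * R\<close>.\<close>
  define \<epsilon>' where "\<epsilon>' = \<epsilon> / (12 * R)"
  have \<epsilon>': "0 < \<epsilon>'" using \<epsilon> R by (simp add: \<epsilon>'_def)
  define PQ where "PQ = (\<lambda>t (y::real). if 0 < y then P t else Q t)"
  define g where "g = (\<lambda>y. \<integral>\<^sup>+t. indicator {0..T} t * ennreal (norm (U (t, h t + y) - PQ t y)) \<partial>lborel)"
  have [measurable]: "g \<in> borel_measurable borel"
    unfolding g_def PQ_def by measurable
  obtain d1 where d1: "0 < d1" "AE y in lborel. \<bar>y\<bar> < d1 \<longrightarrow> g y \<le> ennreal \<epsilon>'"
    using tr[OF \<epsilon>'] unfolding g_def PQ_def by blast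
  obtain d2 where d2: "0 < d2" "\<And>e. \<bar>e\<bar> < d2 \<Longrightarrow> (\<integral>\<^sup>+t. ennreal (norm (P (t + e) - P t)) \<partial>lborel) \<le> ennreal \<epsilon>'"
    using translation_L1_continuous[of P B T \<epsilon>'] P \<epsilon>' by auto
  obtain d3 where d3: "0 < d3" "\<And>e. \<bar>e\<bar> < d3 \<Longrightarrow> (\<integral>\<^sup>+t. ennreal (norm (Q (t + e) - Q t)) \<partial>lborel) \<le> ennreal \<epsilon>'"
    using translation_L1_continuous[of Q B T \<epsilon>'] Q \<epsilon>' by auto
  define d where "d = min (d1 / R) (min d2 d3)"
  show ?thesis
  proof (intro exI[of _ d] conjI allI impI)
    show "0 < d" using d1 d2 d3 R by (simp add: d_def)
    fix e assume "0 < e \<and> e < d"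
    then have e: "0 < e" "e * R < d1" "e < d2" "e < d3"
      using R by (auto simp: d_def field_simps)
    define X where "X = (\<lambda>t s y. ennreal (indicator {0..T} (t + e * s) * indicator {-1..1} s * indicator {-R..R} y *
        norm (U (t + e * s, h (t + e * s) + e * y) - PQ t y)))"
    have PQm[measurable]: "(\<lambda>(t, y). PQ t y) \<in> borel_measurable (borel \<Otimes>\<^sub>M borel)"
      unfolding PQ_def by measurable
    have Xm: "(\<lambda>(t, s, y). X t s y) \<in> borel_measurable (lborel \<Otimes>\<^sub>M (lborel \<Otimes>\<^sub>M lborel))"
      unfolding X_def PQ_def by measurable
    have "AE y in lborel. \<bar>0 + e * y\<bar> < d1 \<longrightarrow> g (0 + e * y) \<le> ennreal \<epsilon>'"
      using e(1) by (intro AE_borel_affine[OF _ _ d1(2)]) simp_all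
    then have g_scaled: "AE y in lborel. y \<in> {-R..R} \<longrightarrow> g (e * y) \<le> ennreal \<epsilon>'"
    proof eventually_elim
      case (elim y)
      have "\<bar>e * y\<bar> < d1" if "y \<in> {-R..R}"
      proof -
        have "\<bar>e * y\<bar> = e * \<bar>y\<bar>" using e by (simp add: abs_mult)
        also have "\<dots> \<le> e * R" using that e by (intro mult_left_mono) auto
        also have "\<dots> < d1" by (rule e)
        finally show ?thesis .
      qed
      then show ?case using elim by simp
    qed
    have inner: "(\<integral>\<^sup>+t. X t s y \<partial>lborel) \<le> indicator {-1..1} s * (indicator {-R..R} y * ennreal (3 * \<epsilon>'))"
      if y: "y \<in> {-R..R} \<longrightarrow> g (e * y) \<le> ennreal \<epsilon>'" for s y
    proof (cases "s \<in> {-1..1} \<and> y \<in> {-R..R}")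
      case False
      then have "X t s y = 0" for t by (auto simp: X_def)
      then show ?thesis by simp
    next
      case True
      have es: "\<bar>e * s\<bar> < d2" "\<bar>e * s\<bar> < d3"
      proof -
        have "\<bar>e * s\<bar> \<le> e * 1" using True e unfolding abs_mult by (intro mult_mono) auto
        then show "\<bar>e * s\<bar> < d2" "\<bar>e * s\<bar> < d3" using e by auto
      qed
      have sgn: "PQ t (e * y) = PQ t y" for t
        using e by (simp add: PQ_def zero_less_mult_iff)
      have "X t s y \<le> indicator {0..T} (t + e * s) * ennreal (norm (U (t + e * s, h (t + e * s) + e * y) - PQ (t + e * s) (e * y)))
          + ennreal (norm (P (t + e * s) - P t)) + ennreal (norm (Q (t + e * s) - Q t))" for t
      proof (cases "t + e * s \<in> {0..T}")
        case True
        have "norm (U (t + e * s, h (t + e * s) + e * y) - PQ t y)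
          \<le> norm (U (t + e * s, h (t + e * s) + e * y) - PQ (t + e * s) y) + norm (PQ (t + e * s) y - PQ t y)"
          by norm
        also have "norm (PQ (t + e * s) y - PQ t y) \<le> norm (P (t + e * s) - P t) + norm (Q (t + e * s) - Q t)"
          by (simp add: PQ_def)
        finally have "norm (U (t + e * s, h (t + e * s) + e * y) - PQ t y)
          \<le> norm (U (t + e * s, h (t + e * s) + e * y) - PQ (t + e * s) y) + norm (P (t + e * s) - P t) + norm (Q (t + e * s) - Q t)"
          by simp
        then have "ennreal (norm (U (t + e * s, h (t + e * s) + e * y) - PQ t y)) \<le> ennreal (norm (U (t + e * s, h (t + e * s) + e * y) - PQ (t + e * s) y)) + ennreal (norm (P (t + e * s) - P t)) + ennreal (norm (Q (t + e * s) - Q t))"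
          by (simp flip: ennreal_plus)
        then show ?thesis
          using True \<open>s \<in> {-1..1} \<and> y \<in> {-R..R}\<close> by (simp add: X_def sgn)
      qed (simp add: X_def)
      then have "(\<integral>\<^sup>+t. X t s y \<partial>lborel) \<le>
          (\<integral>\<^sup>+t. indicator {0..T} (t + e * s) * ennreal (norm (U (t + e * s, h (t + e * s) + e * y) - PQ (t + e * s) (e * y)))
          + ennreal (norm (P (t + e * s) - P t)) + ennreal (norm (Q (t + e * s) - Q t)) \<partial>lborel)"
        by (intro nn_integral_mono)
      also have "\<dots> = (\<integral>\<^sup>+t. indicator {0..T} (t + e * s) * ennreal (norm (U (t + e * s, h (t + e * s) + e * y) - PQ (t + e * s) (e * y))) \<partial>lborel)
          + (\<integral>\<^sup>+t. ennreal (norm (P (t + e * s) - P t)) \<partial>lborel) + (\<integral>\<^sup>+t. ennreal (norm (Q (t + e * s) - Q t)) \<partial>lborel)"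
        by (simp add: nn_integral_add)
      also have "(\<integral>\<^sup>+t. indicator {0..T} (t + e * s) * ennreal (norm (U (t + e * s, h (t + e * s) + e * y) - PQ (t + e * s) (e * y))) \<partial>lborel) = g (e * y)"
        unfolding g_def by (rule nn_integral_shift) measurable
      also have "g (e * y) + (\<integral>\<^sup>+t. ennreal (norm (P (t + e * s) - P t)) \<partial>lborel) + (\<integral>\<^sup>+t. ennreal (norm (Q (t + e * s) - Q t)) \<partial>lborel)
          \<le> ennreal \<epsilon>' + ennreal \<epsilon>' + ennreal \<epsilon>'"
        using y True d2(2)[OF es(1)] d3(2)[OF es(2)] by (intro add_mono) auto
      also have "\<dots> = ennreal (3 * \<epsilon>')"
        using \<epsilon>' by (simp flip: ennreal_plus)
      finally show ?thesis using True by simp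
    qed
    have "(\<integral>\<^sup>+(t, s, y). X t s y \<partial>lborel) = (\<integral>\<^sup>+z. (\<integral>\<^sup>+t. (case z of (s, y) \<Rightarrow> X t s y) \<partial>lborel) \<partial>(lborel \<Otimes>\<^sub>M lborel))"
      using lborel_pair.nn_integral_snd[OF Xm[unfolded lborel_prod[where 'a = real and 'b = real]]] by (simp add: lborel_prod)
    also have "\<dots> = (\<integral>\<^sup>+s. \<integral>\<^sup>+y. \<integral>\<^sup>+t. X t s y \<partial>lborel \<partial>lborel \<partial>lborel)"
    proof (subst lborel.nn_integral_fst[symmetric])
      show "(\<lambda>z. \<integral>\<^sup>+t. (case z of (s, y) \<Rightarrow> X t s y) \<partial>lborel) \<in> borel_measurable (lborel \<Otimes>\<^sub>M lborel)"
        unfolding X_def PQ_def by measurable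
    qed simp
    also have "\<dots> \<le> (\<integral>\<^sup>+s. \<integral>\<^sup>+y. indicator {-1..1::real} s * (indicator {-R..R} y * ennreal (3 * \<epsilon>')) \<partial>lborel \<partial>lborel)"
    proof (rule nn_integral_mono, rule nn_integral_mono_AE)
      show "AE y in lborel. (\<integral>\<^sup>+t. X t s y \<partial>lborel) \<le> indicator {-1..1} s * (indicator {-R..R} y * ennreal (3 * \<epsilon>'))" for s
        using g_scaled by (rule eventually_mono) (rule inner)
    qed
    also have "\<dots> = ennreal 2 * (ennreal (2 * R) * ennreal (3 * \<epsilon>'))"
      using R by (simp add: nn_integral_cmult nn_integral_multc)
    also have "\<dots> = ennreal \<epsilon>"
    proof -
      have "2 * (2 * R * (3 * \<epsilon>')) = \<epsilon>" using R by (simp add: \<epsilon>'_def)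
      then show ?thesis using R \<epsilon>' by (simp add: ennreal_mult[symmetric] del: ennreal_numeral)
    qed
    finally show "(\<integral>\<^sup>+(t0, s, y). ennreal (indicator {0..T} (t0 + e * s) * indicator {-1..1} s * indicator {-R..R} y *
        norm (U (t0 + e * s, h (t0 + e * s) + e * y) - (if 0 < y then P t0 else Q t0))) \<partial>lborel) \<le> ennreal \<epsilon>"
      unfolding X_def PQ_def .
  qed
qed

text \<open>
  Convergence to \<open>0\<close> in \<open>L\<^sup>1\<close> of the variables \<open>(t0, s, y)\<close> jointly gives a subsequence that converges
  almost everywhere, hence, by Fubini's theorem, for almost every \<open>t0\<close> at almost every \<open>(s, y)\<close>.
\<close>

lemma blow_up_sequence:
  fixes U :: "real \<times> real \<Rightarrow> real \<times> real" and h :: "real \<Rightarrow> real" and P Q :: "real \<Rightarrow> real \<times> real"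
  assumes [measurable]: "U \<in> borel_measurable borel" "P \<in> borel_measurable borel" "Q \<in> borel_measurable borel" "h \<in> borel_measurable borel"
    and P: "\<And>t. norm (P t) \<le> B" "\<And>t. t \<notin> {0..T} \<Longrightarrow> P t = 0"
    and Q: "\<And>t. norm (Q t) \<le> B" "\<And>t. t \<notin> {0..T} \<Longrightarrow> Q t = 0"
    and tr: "\<And>\<epsilon>. 0 < \<epsilon> \<Longrightarrow> \<exists>\<delta>>0. AE y in lborel. \<bar>y\<bar> < \<delta> \<longrightarrow>
      (\<integral>\<^sup>+t. indicator {0..T} t * ennreal (norm (U (t, h t + y) - (if 0 < y then P t else Q t))) \<partial>lborel) \<le> ennreal \<epsilon>"
    and R: "1 \<le> R"
  obtains e :: "nat \<Rightarrow> real" where "\<And>n. 0 < e n" "e \<longlonglongrightarrow> 0"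
    "AE t0 in lborel. 0 < t0 \<and> t0 < T \<longrightarrow> (AE z in lborel. \<bar>fst z\<bar> \<le> 1 \<and> \<bar>snd z\<bar> \<le> R \<longrightarrow>
      (\<lambda>n. U (t0 + e n * fst z, h (t0 + e n * fst z) + e n * snd z)) \<longlonglongrightarrow> (if 0 < snd z then P t0 else Q t0))"
proof -
  define X where "X = (\<lambda>e (t0, s, y). indicator {0..T} (t0 + e * s) * indicator {-1..1} s * indicator {-R..R} y *
        norm (U (t0 + e * s, h (t0 + e * s) + e * y) - (if 0 < y then P t0 else Q t0)))"
  have Xm[measurable]: "X e \<in> borel_measurable borel" for e
    unfolding X_def borel_prod[symmetric] by measurable
  have X0: "0 \<le> X e z" for e z
    by (cases z) (simp add: X_def)
  have "\<exists>e. 0 < e \<and> e < 1 / real (Suc n) \<and> (\<integral>\<^sup>+z. ennreal (X e z) \<partial>lborel) \<le> ennreal (1 / real (Suc n))" for n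
  proof -
    obtain d where d: "0 < d" "\<And>e. 0 < e \<and> e < d \<Longrightarrow> (\<integral>\<^sup>+z. ennreal (X e z) \<partial>lborel) \<le> ennreal (1 / real (Suc n))"
      using blow_up_L1[OF assms, of "1 / real (Suc n)"] by (auto simp: X_def case_prod_beta')
    have "0 < min d (1 / real (Suc n))" using d(1) by simp
    from dense[OF this] d(2) show ?thesis by force
  qed
  then obtain e where e: "\<And>n. 0 < e n" "\<And>n. e n < 1 / real (Suc n)"
    and X: "\<And>n. (\<integral>\<^sup>+z. ennreal (X (e n) z) \<partial>lborel) \<le> ennreal (1 / real (Suc n))"
    by metis
  have inverse_lim: "(\<lambda>n. 1 / real (Suc n)) \<longlonglongrightarrow> 0"
    using LIMSEQ_inverse_real_of_nat by (simp add: inverse_eq_divide)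
  have e_lim: "e \<longlonglongrightarrow> 0"
    using e by (intro tendsto_sandwich[OF _ _ tendsto_const inverse_lim] always_eventually allI less_imp_le)
  have X_int: "integrable lborel (X (e n))" for n
    using X[of n] X0 by (intro integrableI_bounded) (auto simp: le_less_trans)
  have "(LINT z|lborel. norm (X (e n) z)) \<le> 1 / real (Suc n)" for n
  proof -
    have "ennreal (LINT z|lborel. norm (X (e n) z)) = (\<integral>\<^sup>+z. ennreal (X (e n) z) \<partial>lborel)"
      using X0 X_int[of n] by (subst nn_integral_eq_integral[symmetric]) auto
    then have "ennreal (LINT z|lborel. norm (X (e n) z)) \<le> ennreal (1 / real (Suc n))"
      using X[of n] by simp
    then show ?thesis
      by (subst (asm) ennreal_le_iff) auto
  qed
  then have "(\<lambda>n. LINT z|lborel. norm (X (e n) z)) \<longlonglongrightarrow> 0"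
    by (intro tendsto_sandwich[OF _ _ tendsto_const inverse_lim] always_eventually allI) simp_all
  from tendsto_L1_AE_subseq[OF X_int this] obtain r where r: "strict_mono r"
    and AE: "AE z in lborel. (\<lambda>n. X (e (r n)) z) \<longlonglongrightarrow> 0"
    by blast
  show thesis
  proof (rule that[of "e \<circ> r"])
    show "0 < (e \<circ> r) n" for n using e by simp
    show er: "(e \<circ> r) \<longlonglongrightarrow> 0" using LIMSEQ_subseq_LIMSEQ[OF e_lim r] .
    have "AE z in lborel \<Otimes>\<^sub>M lborel. (\<lambda>n. X (e (r n)) z) \<longlonglongrightarrow> 0"
      unfolding lborel_prod by (rule AE)
    then have "AE t0 in lborel. AE z in lborel. (\<lambda>n. X (e (r n)) (t0, z)) \<longlonglongrightarrow> 0"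
      by (rule lborel_pair.AE_pair)
    then show "AE t0 in lborel. 0 < t0 \<and> t0 < T \<longrightarrow> (AE z in lborel. \<bar>fst z\<bar> \<le> 1 \<and> \<bar>snd z\<bar> \<le> R \<longrightarrow>
      (\<lambda>n. U (t0 + (e \<circ> r) n * fst z, h (t0 + (e \<circ> r) n * fst z) + (e \<circ> r) n * snd z)) \<longlonglongrightarrow> (if 0 < snd z then P t0 else Q t0))"
    proof eventually_elim
      case (elim t0)
      show ?case
      proof
        assume t0: "0 < t0 \<and> t0 < T"
        show "AE z in lborel. \<bar>fst z\<bar> \<le> 1 \<and> \<bar>snd z\<bar> \<le> R \<longrightarrow>
          (\<lambda>n. U (t0 + (e \<circ> r) n * fst z, h (t0 + (e \<circ> r) n * fst z) + (e \<circ> r) n * snd z)) \<longlonglongrightarrow> (if 0 < snd z then P t0 else Q t0)"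
          using elim
        proof eventually_elim
          case (elim z)
          obtain s y where z: "z = (s, y)" by fastforce
          show ?case
          proof
            assume box: "\<bar>fst z\<bar> \<le> 1 \<and> \<bar>snd z\<bar> \<le> R"
            have "(\<lambda>n. t0 + (e \<circ> r) n * s) \<longlonglongrightarrow> t0 + 0 * s"
              by (intro tendsto_intros er)
            then have "\<forall>\<^sub>F n in sequentially. 0 < t0 + (e \<circ> r) n * s" "\<forall>\<^sub>F n in sequentially. t0 + (e \<circ> r) n * s < T"
              using t0 by (auto dest: order_tendstoD)
            then have "\<forall>\<^sub>F n in sequentially. X (e (r n)) (t0, z) =
                norm (U (t0 + (e \<circ> r) n * fst z, h (t0 + (e \<circ> r) n * fst z) + (e \<circ> r) n * snd z) - (if 0 < snd z then P t0 else Q t0))"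
            proof eventually_elim
              case (elim n)
              then show ?case using box by (auto simp: X_def z abs_le_iff)
            qed
            from Lim_transform_eventually[OF elim this]
            show "(\<lambda>n. U (t0 + (e \<circ> r) n * fst z, h (t0 + (e \<circ> r) n * fst z) + (e \<circ> r) n * snd z)) \<longlonglongrightarrow> (if 0 < snd z then P t0 else Q t0)"
              by (simp add: tendsto_norm_zero_iff LIM_zero_iff)
          qed
        qed
      qed
    qed
  qed
qed

section \<open>Traces along a curve are shocks\<close>

lemma continuous_on_state_cone:
  fixes g :: "real \<times> real \<Rightarrow> real"
  assumes g: "continuous_on nonvacuum g" and vac: "vacuum_limit g"
  shows "continuous_on (state_cone M) g"
  unfolding continuous_on_def
proof
  fix z assume z: "z \<in> state_cone M"
  show "(g \<longlongrightarrow> g z) (at z within state_cone M)"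
  proof (cases "z = (0, 0)")
    case True
    have "state_cone M - {(0, 0)} \<subseteq> {(\<rho>, m). 0 < \<rho> \<and> \<bar>m\<bar> \<le> M * \<rho>}"
    proof
      fix z assume z: "z \<in> state_cone M - {(0, 0)}"
      show "z \<in> {(\<rho>, m). 0 < \<rho> \<and> \<bar>m\<bar> \<le> M * \<rho>}"
        using z by (cases z; cases "fst z = 0") (auto simp: state_cone_def)
    qed
    moreover have "(g \<longlongrightarrow> g (0, 0)) (at (0, 0) within {(\<rho>, m). 0 < \<rho> \<and> \<bar>m\<bar> \<le> M * \<rho>})"
      using vac by (simp add: vacuum_limit_def)
    ultimately have "(g \<longlongrightarrow> g (0, 0)) (at (0, 0) within state_cone M - {(0, 0)})"
      by (rule tendsto_within_subset[rotated])
    then show ?thesis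
      by (simp add: True at_within_def)
  next
    case False
    then have "z \<in> nonvacuum"
      using z by (auto simp: state_cone_def nonvacuum_def)
    then have "isCont g z"
      using g open_nonvacuum by (simp add: continuous_on_eq_continuous_at)
    then show ?thesis
      by (simp add: isCont_def tendsto_within_subset[of g _ z UNIV])
  qed
qed

lemma continuous_on_flux_state_cone: "continuous_on (state_cone M) (snd \<circ> flux)"
proof (rule continuous_on_state_cone)
  have eq: "snd \<circ> flux = (\<lambda>z. (snd z)\<^sup>2 / fst z + (1 / 12) * fst z ^ 3)"
    by (auto simp: flux_def)
  show "continuous_on nonvacuum (snd \<circ> flux)"
  proof -
    have "continuous_on nonvacuum (\<lambda>z. (snd z)\<^sup>2 / fst z)"
      by (intro continuous_on_divide continuous_on_power continuous_on_fst continuous_on_snd continuous_on_id)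
        (auto simp: nonvacuum_def)
    moreover have "continuous_on nonvacuum (\<lambda>z. (1 / 12) * fst z ^ 3)"
      by (intro continuous_on_mult continuous_on_const continuous_on_power continuous_on_fst continuous_on_id)
    ultimately show ?thesis
      unfolding eq by (rule continuous_on_add)
  qed
  show "vacuum_limit (snd \<circ> flux)"
    unfolding vacuum_limit_def
  proof
    fix M :: real
    let ?S = "{(\<rho>, m). 0 < \<rho> \<and> \<bar>m\<bar> \<le> M * \<rho>}"
    have "((\<lambda>z::real \<times> real. M\<^sup>2 * fst z + fst z ^ 3 / 12) \<longlongrightarrow> M\<^sup>2 * fst (0::real, 0::real) + fst (0::real, 0::real) ^ 3 / 12) (at (0, 0) within ?S)"
      by (intro tendsto_intros) simp
    then have upper: "((\<lambda>z::real \<times> real. M\<^sup>2 * fst z + fst z ^ 3 / 12) \<longlongrightarrow> 0) (at (0, 0) within ?S)"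
      by simp
    have "((snd \<circ> flux) \<longlongrightarrow> 0) (at (0, 0) within ?S)"
    proof (rule tendsto_sandwich[OF _ _ tendsto_const upper])
      have "0 \<le> (snd \<circ> flux) z \<and> (snd \<circ> flux) z \<le> M\<^sup>2 * fst z + fst z ^ 3 / 12" if "z \<in> ?S" for z
      proof -
        obtain \<rho> m where z: "z = (\<rho>, m)" "0 < \<rho>" "\<bar>m\<bar> \<le> M * \<rho>" using \<open>z \<in> ?S\<close> by auto
        have "m\<^sup>2 \<le> (M * \<rho>)\<^sup>2" using z(3) abs_le_square_iff[of m "M * \<rho>"] by simp
        then have "m\<^sup>2 / \<rho> \<le> M\<^sup>2 * \<rho>"
          using z(2) by (simp add: pos_divide_le_eq power_mult_distrib power2_eq_square mult_ac)
        then show ?thesis using z by (simp add: flux_def)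
      qed
      then show "\<forall>\<^sub>F z in at (0, 0) within ?S. 0 \<le> (snd \<circ> flux) z"
        "\<forall>\<^sub>F z in at (0, 0) within ?S. (snd \<circ> flux) z \<le> M\<^sup>2 * fst z + fst z ^ 3 / 12"
        unfolding eventually_at_filter by (auto intro!: always_eventually)
    qed
    then show "((snd \<circ> flux) \<longlongrightarrow> (snd \<circ> flux) (0, 0)) (at (0, 0) within ?S)"
      by (simp add: flux_def)
  qed
qed

lemma weak_div_uminus: "weak_div (\<lambda>z. - w z) (\<lambda>z. - g z) \<phi> = - weak_div w g \<phi>"
proof -
  have "(LINT z|lebesgue_on space_time. - w z * frechet_derivative \<phi> (at z) (1, 0) + - g z * frechet_derivative \<phi> (at z) (0, 1))
    = (LINT z|lebesgue_on space_time. - (w z * frechet_derivative \<phi> (at z) (1, 0) + g z * frechet_derivative \<phi> (at z) (0, 1)))"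
    by (intro Bochner_Integration.integral_cong) auto
  then show ?thesis
    unfolding weak_div_def by (simp only: Bochner_Integration.integral_minus)
qed

lemma lipschitz_on_clamp:
  fixes T :: real
  assumes "C-lipschitz_on {0..T} h" "0 \<le> T"
  shows "C-lipschitz_on UNIV (\<lambda>t. h (max 0 (min T t)))"
proof (rule lipschitz_onI)
  fix x y :: real
  have "dist (h (max 0 (min T x))) (h (max 0 (min T y))) \<le> C * dist (max 0 (min T x)) (max 0 (min T y))"
    using assms by (intro lipschitz_onD) auto
  also have "\<dots> \<le> C * dist x y"
    using lipschitz_on_nonneg[OF assms(1)] by (intro mult_left_mono) (auto simp: dist_real_def)
  finally show "dist (h (max 0 (min T x))) (h (max 0 (min T y))) \<le> C * dist x y" .
qed (use lipschitz_on_nonneg[OF assms(1)] in auto)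

lemma lipschitz_on_deriv_le:
  assumes lip: "C-lipschitz_on UNIV h" and der: "(h has_real_derivative \<sigma>) (at t)"
  shows "\<bar>\<sigma>\<bar> \<le> C"
proof -
  have "((\<lambda>y. \<bar>(h y - h t) / (y - t)\<bar>) \<longlongrightarrow> \<bar>\<sigma>\<bar>) (at t)"
    using der by (intro tendsto_rabs) (simp add: has_field_derivative_iff)
  moreover have "\<forall>\<^sub>F y in at t. \<bar>(h y - h t) / (y - t)\<bar> \<le> C"
    unfolding eventually_at_filter
  proof (intro always_eventually allI impI)
    fix y assume "y \<noteq> t"
    then show "\<bar>(h y - h t) / (y - t)\<bar> \<le> C"
      using lipschitz_onD[OF lip, of y t] by (simp add: abs_divide pos_divide_le_eq dist_real_def)
  qed
  ultimately show ?thesis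
    by (rule tendsto_upperbound) simp
qed

text \<open>
  Both halves of the rectangle have positive measure, so each contains a point of convergence.
\<close>

lemma AE_limit_in_closed:
  assumes AE: "AE z in lborel. \<bar>fst z\<bar> \<le> 1 \<and> \<bar>snd z\<bar> \<le> R \<longrightarrow> (\<lambda>n. V n (z :: real \<times> real)) \<longlonglongrightarrow> (if 0 < snd z then a else b)"
    and V: "\<And>n z. V n z \<in> K" and K: "closed K" and R: "1 \<le> R"
  shows "a \<in> K" "b \<in> (K :: 'a::metric_space set)"
proof -
  \<comment> \<open>Rectangles that lie in the upper and in the lower half plane.\<close>
  have ex: "\<exists>z\<in>cbox (0::real, c) (1, c + 1 / 2). (\<lambda>n. V n z) \<longlonglongrightarrow> (if 0 < snd z then a else b)" if "c = 1 / 2 \<or> c = -1" for c :: real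
  proof (rule ccontr)
    assume no: "\<not> ?thesis"
    have "AE z in lborel. z \<notin> cbox (0::real, c) (1, c + 1 / 2)"
      using AE
    proof eventually_elim
      case (elim z)
      show ?case
      proof
        assume z: "z \<in> cbox (0, c) (1, c + 1 / 2)"
        then have "\<bar>fst z\<bar> \<le> 1 \<and> \<bar>snd z\<bar> \<le> R"
          using that R by (cases z) (auto simp: cbox_Pair_eq)
        then show False using elim no z by blast
      qed
    qed
    then have "cbox (0::real, c) (1, c + 1 / 2) \<in> null_sets lborel"
      by (subst AE_iff_null_sets) auto
    then show False
      by (simp add: null_sets_def emeasure_lborel_cbox_eq Basis_prod_def)
  qed
  obtain z where "z \<in> cbox (0, 1 / 2) (1, 1 / 2 + 1 / 2)" "(\<lambda>n. V n z) \<longlonglongrightarrow> (if 0 < snd z then a else b)"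
    using ex[of "1 / 2"] by blast
  then have "(\<lambda>n. V n z) \<longlonglongrightarrow> a" by (cases z) (auto simp: cbox_Pair_eq)
  then show "a \<in> K" by (rule closed_sequentially[OF K V])
  obtain z where "z \<in> cbox (0, -1) (1, -1 + 1 / 2)" "(\<lambda>n. V n z) \<longlonglongrightarrow> (if 0 < snd z then a else b)"
    using ex[of "-1"] by blast
  then have "(\<lambda>n. V n z) \<longlonglongrightarrow> b" by (cases z) (auto simp: cbox_Pair_eq)
  then show "b \<in> K" by (rule closed_sequentially[OF K V])
qed

lemma state_cone_subset_states: "state_cone M \<subseteq> states"
proof
  fix z assume z: "z \<in> state_cone M"
  show "z \<in> states"
    using z by (cases z; cases "fst z = 0") (auto simp: state_cone_def states_def nonvacuum_def)
qed

lemma states_in_state_cone: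
  assumes "z \<in> states" "\<bar>fst z\<bar> \<le> M" "\<bar>snd z / fst z\<bar> \<le> M"
  shows "z \<in> state_cone M"
proof (cases "z = (0, 0)")
  case True
  then show ?thesis using assms by (simp add: state_cone_def)
next
  case False
  then show ?thesis
    using assms by (auto simp: state_cone_def states_def nonvacuum_def abs_divide pos_divide_le_eq)
qed

theorem corollary1:
  fixes u :: "real \<times> real \<Rightarrow> real \<times> real"
    and h :: "real \<Rightarrow> real"
    and u_plus u_minus :: "real \<Rightarrow> real \<times> real"
    and T C :: real
  assumes "bounded_entropy_solution u"
    and "C-lipschitz_on {0..T} h"
    and "strong_traces T u h u_plus u_minus"
  shows "AE t in lebesgue_on {0..T}. u_plus t = u_minus t \<or>
    (\<exists>\<sigma>. (h has_real_derivative \<sigma>) (at t within {0..T}) \<and>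
      admissible_shock (u_minus t) (u_plus t) \<sigma>)"
proof (cases "0 \<le> T")
  case False
  then show ?thesis by (simp add: AE_restrict_space_iff)
next
  case T: True
  \<comment> \<open>The curve is continued by constants, so that it is Lipschitz on the whole line.\<close>
  define k where "k = (\<lambda>t. h (max 0 (min T t)))"
  have lip: "C-lipschitz_on UNIV k"
    unfolding k_def by (rule lipschitz_on_clamp[OF assms(2) T])
  have C0: "0 \<le> C" using lip lipschitz_on_nonneg by blast
  have k_meas: "k \<in> borel_measurable borel"
    using lipschitz_on_continuous_on[OF lip] by (rule borel_measurable_continuous_onI)
  have hk: "h t = k t" if "t \<in> {0..T}" for t
    using that by (simp add: k_def)
  have st: "space_time \<in> sets borel"
    by (simp add: space_time_def open_Times borel_open)
  from assms(1) obtain M where u_meas: "u \<in> borel_measurable (lebesgue_on space_time)"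
    and M: "AE z in lebesgue_on space_time. u z \<in> states \<and> \<bar>fst (u z)\<bar> \<le> M \<and> \<bar>snd (u z) / fst (u z)\<bar> \<le> M"
    unfolding bounded_entropy_solution_def by blast
  define K where "K = state_cone (max M 0)"
  have K: "closed K" "0 \<in> K"
    using compact_imp_closed[OF compact_state_cone] by (auto simp: K_def state_cone_def zero_prod_def)
  have uK: "AE z in lebesgue_on space_time. u z \<in> K"
    using M unfolding K_def by eventually_elim (auto intro!: states_in_state_cone)
  obtain U where U: "U \<in> borel_measurable borel" "\<And>z. U z \<in> K" "\<And>z. z \<notin> space_time \<Longrightarrow> U z = 0"
    and uU: "AE z in lborel. z \<in> space_time \<longrightarrow> u z = U z"
    by (rule borel_version[OF u_meas st K uK]) (rule that, assumption, blast, blast, assumption)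
  have traces: "Linf T u_plus" "Linf T u_minus"
    using assms(3) by (auto simp: strong_traces_def)
  have trace_version: "\<exists>P B. P \<in> borel_measurable borel \<and> (\<forall>t. norm (P t) \<le> B) \<and> (\<forall>t. t \<notin> {0..T} \<longrightarrow> P t = 0) \<and>
      (AE t in lborel. t \<in> {0..T} \<longrightarrow> v t = P t)" if v: "Linf T v" for v
  proof -
    obtain B where v_meas: "v \<in> borel_measurable (lebesgue_on {0..T})" and B: "AE t in lebesgue_on {0..T}. norm (v t) \<le> B"
      using v unfolding Linf_def by blast
    have ball: "closed (cball (0 :: real \<times> real) (max B 0))" "0 \<in> cball (0 :: real \<times> real) (max B 0)"
      by auto
    have v_ball: "AE t in lebesgue_on {0..T}. v t \<in> cball 0 (max B 0)"
      using B by eventually_elim auto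
    have "{0..T} \<in> sets borel" by simp
    then obtain P where P: "P \<in> borel_measurable borel" "\<And>t. P t \<in> cball 0 (max B 0)"
      "\<And>t. t \<notin> {0..T} \<Longrightarrow> P t = 0" "AE t in lborel. t \<in> {0..T} \<longrightarrow> v t = P t"
      by (rule borel_version[OF v_meas _ ball v_ball]) (rule that, assumption, blast, blast, assumption)
    then show ?thesis by (intro exI[of _ P] exI[of _ "max B 0"]) auto
  qed
  obtain P BP where P: "P \<in> borel_measurable borel" "\<And>t. norm (P t) \<le> BP" "\<And>t. t \<notin> {0..T} \<Longrightarrow> P t = 0"
    and uP: "AE t in lborel. t \<in> {0..T} \<longrightarrow> u_plus t = P t"
    using trace_version[OF traces(1)] by blast
  obtain Q BQ where Q: "Q \<in> borel_measurable borel" "\<And>t. norm (Q t) \<le> BQ" "\<And>t. t \<notin> {0..T} \<Longrightarrow> Q t = 0"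
    and uQ: "AE t in lborel. t \<in> {0..T} \<longrightarrow> u_minus t = Q t"
    using trace_version[OF traces(2)] by blast
  have PQ_bound: "norm (P t) \<le> max BP BQ" "norm (Q t) \<le> max BP BQ" for t
    using P(2)[of t] Q(2)[of t] by auto
  define R where "R = 1 + 2 * C"
  have R: "1 \<le> R" using C0 by (simp add: R_def)
  note tr = strong_traces_L1[OF assms(3) U(1) P(1) Q(1) k_meas uU uP uQ hk]
  obtain e :: "nat \<Rightarrow> real" where e: "\<And>n. 0 < e n" "e \<longlonglongrightarrow> 0"
    and blow: "AE t0 in lborel. 0 < t0 \<and> t0 < T \<longrightarrow> (AE z in lborel. \<bar>fst z\<bar> \<le> 1 \<and> \<bar>snd z\<bar> \<le> R \<longrightarrow>
      (\<lambda>n. U (t0 + e n * fst z, k (t0 + e n * fst z) + e n * snd z)) \<longlonglongrightarrow> (if 0 < snd z then P t0 else Q t0))"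
    by (rule blow_up_sequence[OF U(1) P(1) Q(1) k_meas PQ_bound(1) P(3) PQ_bound(2) Q(3) tr R]) (assumption+, rule that, blast, assumption, assumption)
  have "AE t in lborel. t \<in> {0..T} \<longrightarrow> u_plus t = u_minus t \<or>
    (\<exists>\<sigma>. (h has_real_derivative \<sigma>) (at t within {0..T}) \<and> admissible_shock (u_minus t) (u_plus t) \<sigma>)"
    using blow uP uQ lipschitz_AE_differentiable[OF lip] AE_lborel_singleton[of "0::real"] AE_lborel_singleton[of T]
  proof eventually_elim
    case (elim t)
    show ?case
    proof
      assume tT: "t \<in> {0..T}"
      then have t: "0 < t" "t < T" using elim by auto
      obtain \<sigma> where der: "(k has_real_derivative \<sigma>) (at t)" using elim by blast
      define uR where "uR = u_plus t"
      define uL where "uL = u_minus t"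
      have conv: "AE z in lborel. \<bar>fst z\<bar> \<le> 1 \<and> \<bar>snd z\<bar> \<le> 1 + 2 * C \<longrightarrow>
        (\<lambda>n. U (t + e n * fst z, k (t + e n * fst z) + e n * snd z)) \<longlonglongrightarrow> (if 0 < snd z then uR else uL)"
      proof -
        have "uR = P t" "uL = Q t" using elim tT by (auto simp: uR_def uL_def)
        then show ?thesis using elim(1) t unfolding R_def by blast
      qed
      have in_K: "uR \<in> K" "uL \<in> K"
        using AE_limit_in_closed[OF conv U(2) K(1)] R by (auto simp: R_def)
      have jump: "g uR - g uL \<le> \<sigma> * (w uR - w uL)"
        if "continuous_on K w" "continuous_on K g"
          "\<And>\<phi>. test_function \<phi> \<Longrightarrow> (\<forall>z. 0 \<le> \<phi> z) \<Longrightarrow> weak_div (w \<circ> u) (g \<circ> u) \<phi> \<le> 0" for w g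
        using that in_K test_function_moving_bump[OF e(1)] unfolding K_def
        by (intro jump_inequality_of_blow_up[OF U(1) U(2)[unfolded K_def] uU lip der
              lipschitz_on_deriv_le[OF lip der] t(1) e _ _ _ _ conv]) auto
      have flux_jump: "g uR - g uL = \<sigma> * (w uR - w uL)"
        if "continuous_on K w" "continuous_on K g" "\<And>\<phi>. test_function \<phi> \<Longrightarrow> weak_div (w \<circ> u) (g \<circ> u) \<phi> = 0" for w g
      proof (rule antisym)
        show "g uR - g uL \<le> \<sigma> * (w uR - w uL)"
          using that by (intro jump) auto
        have "(\<lambda>z. - g z) uR - (\<lambda>z. - g z) uL \<le> \<sigma> * ((\<lambda>z. - w z) uR - (\<lambda>z. - w z) uL)"
          using that weak_div_uminus[of "w \<circ> u" "g \<circ> u"] by (intro jump) (auto simp: o_def intro: continuous_intros)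
        then show "\<sigma> * (w uR - w uL) \<le> g uR - g uL"
          by (simp add: algebra_simps)
      qed
      have "(h has_real_derivative \<sigma>) (at t within {0..T})"
        unfolding has_field_derivative_def
        by (rule has_derivative_transform[OF tT hk])
          (use DERIV_subset[OF der, of "{0..T}"] in \<open>simp_all add: has_field_derivative_def\<close>)
      moreover have "admissible_shock uL uR \<sigma>" if "uR \<noteq> uL"
        unfolding admissible_shock_def
      proof (intro conjI allI impI)
        show "uL \<in> states" "uR \<in> states" "uL \<noteq> uR"
          using in_K state_cone_subset_states that by (auto simp: K_def)
        have fst_flux: "fst \<circ> flux = snd" by (auto simp: flux_def)
        have conservation: "weak_div (fst \<circ> u) (fst \<circ> flux \<circ> u) \<phi> = 0"
          "weak_div (snd \<circ> u) (snd \<circ> flux \<circ> u) \<phi> = 0" if "test_function \<phi>" for \<phi>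
          using assms(1) that unfolding bounded_entropy_solution_def by blast+
        have "(fst \<circ> flux) uR - (fst \<circ> flux) uL = \<sigma> * (fst uR - fst uL)"
        proof (rule flux_jump)
          show "continuous_on K fst" "continuous_on K (fst \<circ> flux)"
            unfolding fst_flux by (intro continuous_intros)+
        qed (rule conservation)
        moreover have "(snd \<circ> flux) uR - (snd \<circ> flux) uL = \<sigma> * (snd uR - snd uL)"
        proof (rule flux_jump)
          show "continuous_on K snd" "continuous_on K (snd \<circ> flux)"
            unfolding K_def by (intro continuous_intros continuous_on_flux_state_cone)+
        qed (rule conservation)
        ultimately show "flux uR - flux uL = \<sigma> *\<^sub>R (uR - uL)"
          by (simp add: prod_eq_iff)
        have entropy: "q uR - q uL \<le> \<sigma> * (\<eta> uR - \<eta> uL)" if "entropy_pair \<eta> q" "vacuum_limit \<eta>" "vacuum_limit q" for \<eta> q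
        proof (rule jump)
          show "continuous_on K \<eta>" "continuous_on K q"
            using that by (auto simp: K_def entropy_pair_def intro: continuous_on_state_cone)
          show "weak_div (\<eta> \<circ> u) (q \<circ> u) \<phi> \<le> 0" if "test_function \<phi>" "\<forall>z. 0 \<le> \<phi> z" for \<phi>
            using assms(1) that \<open>entropy_pair \<eta> q\<close> \<open>vacuum_limit \<eta>\<close> \<open>vacuum_limit q\<close>
            unfolding bounded_entropy_solution_def by blast
        qed
        fix \<eta> q
        assume *: "entropy_pair \<eta> q \<and> (vacuum_limit \<eta> \<and> vacuum_limit q \<or> uL \<in> nonvacuum \<and> uR \<in> nonvacuum)"
        show "q uR - q uL \<le> \<sigma> * (\<eta> uR - \<eta> uL)"
        proof (cases "vacuum_limit \<eta> \<and> vacuum_limit q")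
          case True
          then show ?thesis using * entropy by blast
        next
          case False
          then have nv: "uL \<in> nonvacuum" "uR \<in> nonvacuum" using * by auto
          obtain \<eta>' q' where "entropy_pair \<eta>' q'" "vacuum_limit \<eta>'" "vacuum_limit q'"
            "\<And>v. v \<in> nonvacuum \<Longrightarrow> \<eta>' v = \<eta> v \<and> q' v = q v"
            using entropy_pair_vacuum_extension * by blast
          then show ?thesis using entropy[of \<eta>' q'] nv by simp
        qed
      qed
      ultimately show "u_plus t = u_minus t \<or>
        (\<exists>\<sigma>. (h has_real_derivative \<sigma>) (at t within {0..T}) \<and> admissible_shock (u_minus t) (u_plus t) \<sigma>)"
        unfolding uR_def uL_def by blast
    qed
  qed
  then show ?thesis
    by (simp add: AE_restrict_space_iff AE_completion_iff)
qed

end
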